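(* Let $m,\ell\in\mathbb{N}$, let $\mathcal{N}$ be a finite set and $\{D_\sigma:\sigma\in\mathcal{N}\}$ a partition of $\mathbb{Z}^d$, and let $\mathcal{A}=\{a_1,\dots,a_m\}\subset\ell^2(\mathbb{Z}^d)$ be given. Let $\mathcal{D}_{\mathcal{N}}^{\ell}$ be the class of all subspaces $S\subset\ell^2(\mathbb{Z}^d)$ with $\dim(S)\le\ell$ and $S_\sigma\subseteq S$ for all $\sigma\in\mathcal{N}$, where $S_\sigma=\{\mathbf{1}_{D_\sigma}a:a\in S\}$. Then there exists $S^*\in\mathcal{D}_{\mathcal{N}}^{\ell}$ that satisfies $$\sum_{j=1}^{m}\|a_j-P_{S^*}a_j\|^2\le\sum_{j=1}^{m}\|a_j-P_Sa_j\|^2\qquad\text{for all }S\in\mathcal{D}_{\mathcal{N}}^{\ell}.$$ Moreover, with $q_1,\dots,q_\ell$, $\Lambda$ and $\Lambda_\ell$ as defined in the context: (1) $S^*=\mathrm{span}\{q_1,\dots,q_\ell\}$, and the vectors $\{q_1,\dots,q_\ell\}$ form a Parseval frame for $S^*$. (2) The error in the approximation is $$\sum_{j=1}^{m}\|a_j-P_{S^*}a_j\|^2=\sum_{\lambda\in\Lambda\setminus\Lambda_\ell}\lambda .$$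
   Context: $P_S$ is the orthogonal projection onto $S$. For $a\in\ell^2(\mathbb{Z}^d)$ and $\sigma\in\mathcal{N}$, $a^\sigma=\mathbf{1}_{D_\sigma}a$, where $\mathbf{1}_{D_\sigma}$ is the indicator of $D_\sigma$. For $\sigma\in\mathcal{N}$ let $G_\sigma\in\mathbb{C}^{m\times m}$ be the Gramian matrix $(G_\sigma)_{k,l}=\langle a_k^\sigma,a_l^\sigma\rangle$ (inner product linear in the first variable), with eigenvalues $\lambda_1^\sigma\ge\dots\ge\lambda_m^\sigma$ counted with multiplicity and corresponding orthonormal left eigenvectors $y_1^\sigma,\dots,y_m^\sigma\in\mathbb{C}^m$, i.e. $(y_j^\sigma)^tG_\sigma=\lambda_j^\sigma(y_j^\sigma)^t$; write $y_j^\sigma=(y_j^\sigma(1),\dots,y_j^\sigma(m))$. Let $\Lambda=\{\lambda_j^\sigma:j=1,\dots,m,\ \sigma\in\mathcal{N}\}$, regarded as a family indexed by the pairs $(\sigma,j)$ (so with multiplicity), and let $\Lambda_\ell=\{\lambda_1,\dots,\lambda_\ell\}$ collect the $\ell$ biggest elements of $\Lambda$: if $\lambda\in\Lambda_\ell$ then $\lambda\ge\mu$ for all $\mu\in\Lambda\setminus\Lambda_\ell$. For $s=1,\dots,\ell$, let $(\sigma_s,j_s)$ be the index with $\lambda_s=\lambda_{j_s}^{\sigma_s}$ (distinct $s$ corresponding to distinct indices), and define $$q_s=\lambda_s^{-1/2}\sum_{k=1}^m y_{j_s}^{\sigma_s}(k)\,a_k^{\sigma_s}\quad\text{if }\lambda_s\ne0,\qquad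 q_s=0\quad\text{if }\lambda_s=0 .$$ A Parseval frame of a Hilbert space $H$ is a family $\{g_n\}\subset H$ with $\sum_n|\langle f,g_n\rangle|^2=\|f\|^2$ for all $f\in H$. *)

theory Defs
  imports
    "HOL-Analysis.Analysis"
    "HOL-Library.Function_Algebras"
    "Jordan_Normal_Form.Char_Poly"
begin

unbundle no vec_syntax

text \<open>
  Sequences are functions \<^typ>\<open>'a \<Rightarrow> complex\<close>; the lattice \<open>\<int>\<^sup>d\<close> is the type \<^typ>\<open>int ^ 'd\<close>.
  The pointwise additive structure comes from \<^theory>\<open>HOL-Library.Function_Algebras\<close>; the interpretation
  below provides the library notions of complex subspace, span and dimension. All finite families
  are indexed from 0, so indices range over \<open>{..<m}\<close> and \<open>{..<l}\<close>.
\<close>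

definition cscale :: "complex \<Rightarrow> ('a \<Rightarrow> complex) \<Rightarrow> 'a \<Rightarrow> complex" where
  "cscale c f = (\<lambda>x. c * f x)"

global_interpretation cfun: vector_space cscale
  by unfold_locales (simp_all add: cscale_def fun_eq_iff algebra_simps)

definition l2 :: "('a \<Rightarrow> complex) set" where
  "l2 = {f. (\<lambda>x. (cmod (f x))\<^sup>2) summable_on UNIV}"

definition l2_inner :: "('a \<Rightarrow> complex) \<Rightarrow> ('a \<Rightarrow> complex) \<Rightarrow> complex" where
  "l2_inner f g = (\<Sum>\<^sub>\<infinity>x. f x * cnj (g x))"

definition l2_norm :: "('a \<Rightarrow> complex) \<Rightarrow> real" where
  "l2_norm f = sqrt (\<Sum>\<^sub>\<infinity>x. (cmod (f x))\<^sup>2)"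

text \<open>
  Only used for finite-dimensional subspaces \<open>S\<close> of \<^term>\<open>l2\<close> and \<open>f \<in> l2\<close>, where the described
  vector exists and is unique.
\<close>

definition orth_proj :: "('a \<Rightarrow> complex) set \<Rightarrow> ('a \<Rightarrow> complex) \<Rightarrow> 'a \<Rightarrow> complex" where
  "orth_proj S f = (THE g. g \<in> S \<and> (\<forall>h\<in>S. l2_inner (f - g) h = 0))"

definition trunc :: "'a set \<Rightarrow> ('a \<Rightarrow> complex) \<Rightarrow> 'a \<Rightarrow> complex" where
  "trunc E f = (\<lambda>x. indicator E x * f x)"

text \<open>
  Finite dimensionality has to be required separately, because \<^const>\<open>cfun.dim\<close> is 0 on
  infinite-dimensional spaces.
\<close>

definition subspace_class ::
    "'n set \<Rightarrow> ('n \<Rightarrow> 'a set) \<Rightarrow> nat \<Rightarrow> ('a \<Rightarrow> complex) set set" where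
  "subspace_class N D l = {S. S \<subseteq> l2 \<and> cfun.subspace S
      \<and> (\<exists>B. finite B \<and> cfun.span B = S) \<and> cfun.dim S \<le> l
      \<and> (\<forall>\<sigma>\<in>N. trunc (D \<sigma>) ` S \<subseteq> S)}"

definition approx_error ::
    "nat \<Rightarrow> (nat \<Rightarrow> 'a \<Rightarrow> complex) \<Rightarrow> ('a \<Rightarrow> complex) set \<Rightarrow> real" where
  "approx_error m a S = (\<Sum>j<m. (l2_norm (a j - orth_proj S (a j)))\<^sup>2)"

definition gramian :: "nat \<Rightarrow> (nat \<Rightarrow> 'a \<Rightarrow> complex) \<Rightarrow> complex mat" where
  "gramian m b = mat m m (\<lambda>(k, i). l2_inner (b k) (b i))"

text \<open>
  The second line says that \<open>lam 0, \<dots>, lam (m - 1)\<close> are the eigenvalues counted with algebraic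
  multiplicity; the third is \<open>y\<^sup>t G = \<lambda> y\<^sup>t\<close>, transposed.
\<close>

definition left_eigensystem ::
    "nat \<Rightarrow> complex mat \<Rightarrow> (nat \<Rightarrow> real) \<Rightarrow> (nat \<Rightarrow> complex vec) \<Rightarrow> bool" where
  "left_eigensystem m G lam y \<longleftrightarrow>
      (\<forall>i j. i \<le> j \<and> j < m \<longrightarrow> lam j \<le> lam i)
    \<and> char_poly G = (\<Prod>j<m. [:- complex_of_real (lam j), 1:])
    \<and> (\<forall>j<m. y j \<in> carrier_vec m \<and> G\<^sup>T *\<^sub>v y j = complex_of_real (lam j) \<cdot>\<^sub>v y j)
    \<and> (\<forall>i<m. \<forall>j<m. y i \<bullet>c y j = (if i = j then 1 else 0))"

text \<open>
  \<^term>\<open>top_selection I lam l sel\<close>: the family \<^term>\<open>lam\<close> over the finite index set \<^term>\<open>I\<close> attains its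
  \<^term>\<open>l\<close> biggest members, with multiplicity, at the distinct indices \<open>sel 0, \<dots>, sel (l - 1)\<close>.
  If \<^term>\<open>I\<close> has fewer than \<^term>\<open>l\<close> elements, all of them are selected, and the vectors
  \<open>q_vec\<close> left over are 0 by convention.
\<close>

definition top_selection :: "'i set \<Rightarrow> ('i \<Rightarrow> real) \<Rightarrow> nat \<Rightarrow> (nat \<Rightarrow> 'i) \<Rightarrow> bool" where
  "top_selection I lam l sel \<longleftrightarrow>
      inj_on sel {..<min l (card I)} \<and> sel ` {..<min l (card I)} \<subseteq> I
    \<and> (\<forall>p \<in> sel ` {..<min l (card I)}. \<forall>p' \<in> I - sel ` {..<min l (card I)}. lam p' \<le> lam p)"

definition q_vec ::
    "'n set \<Rightarrow> ('n \<Rightarrow> 'a set) \<Rightarrow> nat \<Rightarrow> (nat \<Rightarrow> 'a \<Rightarrow> complex) \<Rightarrow> ('n \<Rightarrow> nat \<Rightarrow> real)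
      \<Rightarrow> ('n \<Rightarrow> nat \<Rightarrow> complex vec) \<Rightarrow> (nat \<Rightarrow> 'n \<times> nat) \<Rightarrow> nat \<Rightarrow> 'a \<Rightarrow> complex" where
  "q_vec N D m a lam y sel s = (case sel s of (\<sigma>, j) \<Rightarrow>
      if s < card (N \<times> {..<m}) \<and> lam \<sigma> j \<noteq> 0
      then cscale (complex_of_real (lam \<sigma> j powr (- 1 / 2)))
             (\<Sum>k<m. cscale (y \<sigma> j $ k) (trunc (D \<sigma>) (a k)))
      else 0)"

definition parseval_frame ::
    "'i set \<Rightarrow> ('i \<Rightarrow> 'a \<Rightarrow> complex) \<Rightarrow> ('a \<Rightarrow> complex) set \<Rightarrow> bool" where
  "parseval_frame I g H \<longleftrightarrow> (\<forall>i\<in>I. g i \<in> H)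
    \<and> (\<forall>f\<in>H. ((\<lambda>i. (cmod (l2_inner f (g i)))\<^sup>2) has_sum (l2_norm f)\<^sup>2) I)"

end

theory Submission
  imports Defs "Jordan_Normal_Form.Schur_Decomposition"
begin

text \<open>
  A subspace \<open>S\<close> of the class is invariant under all truncations, so it has an orthonormal basis \<open>E\<close>
  each of whose vectors is supported in a single block \<open>D \<sigma>\<close> (\<open>adapted_orthonormal_basis\<close>).
  By Pythagoras the error of \<open>S\<close> is the fixed total \<open>\<Sum>k. \<parallel>a k\<parallel>\<^sup>2\<close> minus the energy
  \<open>\<Sum>e\<in>E. \<Sum>k. \<bar>\<langle>a k, e\<rangle>\<bar>\<^sup>2\<close> that \<open>S\<close> captures.

  Replace the truncated data \<open>a k\<^sup>\<sigma>\<close> by the combinations \<open>v (\<sigma>, j) = \<Sum>k. y \<sigma> j k * a k\<^sup>\<sigma>\<close>. The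
  coefficient vectors \<open>y \<sigma> j\<close> form a unitary matrix, so for a vector \<open>e\<close> supported in one block the energy
  \<open>\<Sum>k. \<bar>\<langle>a k, e\<rangle>\<bar>\<^sup>2\<close> equals \<open>\<Sum>p. \<bar>\<langle>v p, e\<rangle>\<bar>\<^sup>2\<close> (\<open>captured_energy\<close>); and as the \<open>y \<sigma> j\<close> are left
  eigenvectors of the Gramian, the \<open>v p\<close> are pairwise orthogonal with \<open>\<parallel>v p\<parallel>\<^sup>2\<close> the eigenvalue \<open>\<lambda> p\<close>.
  In terms of the normalised vectors \<open>u p\<close> the captured energy becomes \<open>\<Sum>p. \<lambda> p * w p\<close> with
  \<open>w p = \<Sum>e\<in>E. \<bar>\<langle>u p, e\<rangle>\<bar>\<^sup>2\<close>. Bessel's inequality, applied once to \<open>E\<close> and once to the \<open>u p\<close>, gives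
  \<open>w p \<le> 1\<close> and \<open>\<Sum>p. w p \<le> card E \<le> l\<close>. Under these constraints a weighted sum of the \<open>\<lambda> p\<close> cannot
  exceed the sum of the \<open>l\<close> largest ones (\<open>weighted_sum_le_top_sum\<close>), and the span of the selected \<open>u p\<close>,
  that is, of the vectors \<open>q s\<close>, attains this bound.

  The existence statement also needs an eigensystem to start from. It comes from Schur triangularisation: a
  symmetric operator that is triangular along a flag is diagonal in the basis obtained
  from the flag by Gram-Schmidt (\<open>symmetric_triangular_imp_diagonal\<close>).
\<close>

section \<open>The inner product of square-summable families\<close>

lemma l2_scale: "f \<in> l2 \<Longrightarrow> cscale c f \<in> l2"
  by (simp add: l2_def cscale_def norm_mult power_mult_distrib summable_on_cmult_right)

lemma l2_zero: "0 \<in> l2"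
  by (simp add: l2_def)

lemma l2_add:
  assumes "f \<in> l2" "g \<in> l2"
  shows "f + g \<in> l2"
proof -
  have "(\<lambda>x. 2 * (cmod (f x))\<^sup>2 + 2 * (cmod (g x))\<^sup>2) summable_on UNIV"
    using assms by (intro summable_on_add summable_on_cmult_right) (auto simp: l2_def)
  then have "(\<lambda>x. (cmod (f x + g x))\<^sup>2) summable_on UNIV"
  proof (rule summable_on_comparison_test)
    fix x
    have "(cmod (f x + g x))\<^sup>2 \<le> (cmod (f x) + cmod (g x))\<^sup>2"
      by (intro power_mono norm_triangle_ineq) auto
    also have "\<dots> \<le> 2 * (cmod (f x))\<^sup>2 + 2 * (cmod (g x))\<^sup>2"
      using sum_squares_bound[of "cmod (f x)" "cmod (g x)"] by (simp add: power2_sum)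
    finally show "(cmod (f x + g x))\<^sup>2 \<le> 2 * (cmod (f x))\<^sup>2 + 2 * (cmod (g x))\<^sup>2" .
  qed auto
  then show ?thesis by (simp add: l2_def)
qed

lemma l2_subspace: "cfun.subspace l2"
  by (intro cfun.subspaceI l2_zero l2_add l2_scale)

lemma l2_diff: "f \<in> l2 \<Longrightarrow> g \<in> l2 \<Longrightarrow> f - g \<in> l2"
  by (rule cfun.subspace_diff[OF l2_subspace])

lemma l2_sum: "(\<And>i. i \<in> I \<Longrightarrow> f i \<in> l2) \<Longrightarrow> (\<Sum>i\<in>I. f i) \<in> l2"
  by (rule cfun.subspace_sum[OF l2_subspace])

lemma l2_span: "B \<subseteq> l2 \<Longrightarrow> cfun.span B \<subseteq> l2"
  by (rule cfun.span_minimal[OF _ l2_subspace])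

lemma l2_trunc:
  assumes "f \<in> l2"
  shows "trunc E f \<in> l2"
proof -
  have "(\<lambda>x. (cmod (f x))\<^sup>2) summable_on UNIV"
    using assms by (simp add: l2_def)
  then have "(\<lambda>x. (cmod (trunc E f x))\<^sup>2) summable_on UNIV"
    by (rule summable_on_comparison_test) (auto simp: trunc_def indicator_def)
  then show ?thesis by (simp add: l2_def)
qed

lemma l2_inner_summable:
  assumes "f \<in> l2" "g \<in> l2"
  shows "(\<lambda>x. f x * cnj (g x)) summable_on UNIV"
proof -
  have "(\<lambda>x. (cmod (f x))\<^sup>2 + (cmod (g x))\<^sup>2) summable_on UNIV"
    using assms by (intro summable_on_add) (auto simp: l2_def)
  then have "(\<lambda>x. norm (f x * cnj (g x))) summable_on UNIV"
  proof (rule summable_on_comparison_test)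
    fix x
    have "2 * (cmod (f x) * cmod (g x)) \<le> (cmod (f x))\<^sup>2 + (cmod (g x))\<^sup>2"
      using sum_squares_bound[of "cmod (f x)" "cmod (g x)"] by simp
    moreover have "0 \<le> cmod (f x) * cmod (g x)" by simp
    ultimately have "cmod (f x) * cmod (g x) \<le> (cmod (f x))\<^sup>2 + (cmod (g x))\<^sup>2"
      by linarith
    then show "norm (f x * cnj (g x)) \<le> (cmod (f x))\<^sup>2 + (cmod (g x))\<^sup>2"
      by (simp add: norm_mult)
  qed auto
  then show ?thesis by (rule abs_summable_summable)
qed

lemma l2_inner_commute: "l2_inner f g = cnj (l2_inner g f)"
  by (simp add: l2_inner_def mult.commute flip: infsum_cnj)

lemma l2_inner_zero_left [simp]: "l2_inner 0 g = 0"
  by (simp add: l2_inner_def)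

lemma l2_inner_zero_right [simp]: "l2_inner f 0 = 0"
  by (simp add: l2_inner_def)

lemma l2_inner_add_left:
  assumes "f \<in> l2" "g \<in> l2" "h \<in> l2"
  shows "l2_inner (f + g) h = l2_inner f h + l2_inner g h"
  using assms by (simp add: l2_inner_def distrib_right infsum_add l2_inner_summable)

lemma l2_inner_scale_left:
  assumes "f \<in> l2" "h \<in> l2"
  shows "l2_inner (cscale c f) h = c * l2_inner f h"
  using l2_inner_summable[OF assms]
  by (simp add: l2_inner_def cscale_def mult.assoc infsum_cmult_right)

lemma l2_inner_scale_right:
  assumes "f \<in> l2" "h \<in> l2"
  shows "l2_inner h (cscale c f) = cnj c * l2_inner h f"
  unfolding l2_inner_commute[of h] by (simp only: l2_inner_scale_left[OF assms] complex_cnj_mult)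

lemma l2_inner_diff_left:
  assumes "f \<in> l2" "g \<in> l2" "h \<in> l2"
  shows "l2_inner (f - g) h = l2_inner f h - l2_inner g h"
proof -
  have "l2_inner f h = l2_inner (f - g) h + l2_inner g h"
    using l2_inner_add_left[OF l2_diff[OF assms(1,2)] assms(2,3)] by simp
  then show ?thesis by simp
qed

lemma l2_inner_diff_right:
  assumes "f \<in> l2" "g \<in> l2" "h \<in> l2"
  shows "l2_inner h (f - g) = l2_inner h f - l2_inner h g"
  unfolding l2_inner_commute[of h] by (simp only: l2_inner_diff_left[OF assms] complex_cnj_diff)

lemma l2_inner_sum_left:
  assumes "\<And>i. i \<in> I \<Longrightarrow> f i \<in> l2" "h \<in> l2"
  shows "l2_inner (\<Sum>i\<in>I. f i) h = (\<Sum>i\<in>I. l2_inner (f i) h)"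
  using assms
proof (induction I rule: infinite_finite_induct)
  case (insert i I)
  then show ?case by (simp add: l2_inner_add_left l2_sum del: plus_fun_apply)
qed (simp_all del: zero_fun_apply)

lemma l2_inner_sum_right:
  assumes "\<And>i. i \<in> I \<Longrightarrow> f i \<in> l2" "h \<in> l2"
  shows "l2_inner h (\<Sum>i\<in>I. f i) = (\<Sum>i\<in>I. l2_inner h (f i))"
  unfolding l2_inner_commute[of h] by (simp only: l2_inner_sum_left[OF assms] cnj_sum)

lemma l2_norm_power2: "(l2_norm f)\<^sup>2 = (\<Sum>\<^sub>\<infinity>x. (cmod (f x))\<^sup>2)"
  by (simp add: l2_norm_def infsum_nonneg)

lemma l2_inner_self:
  assumes "f \<in> l2"
  shows "l2_inner f f = complex_of_real ((l2_norm f)\<^sup>2)"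
proof -
  have "((\<lambda>x. (cmod (f x))\<^sup>2) has_sum (l2_norm f)\<^sup>2) UNIV"
    unfolding l2_norm_power2 using assms by (intro has_sum_infsum) (simp add: l2_def)
  then have "((\<lambda>x. complex_of_real ((cmod (f x))\<^sup>2)) has_sum complex_of_real ((l2_norm f)\<^sup>2)) UNIV"
    by (rule has_sum_of_real)
  then show ?thesis
    by (simp add: l2_inner_def infsumI flip: complex_norm_square)
qed

lemma l2_inner_self_eq_0:
  assumes "f \<in> l2" "l2_inner f f = 0"
  shows "f = 0"
proof
  fix x
  have "(\<lambda>x. (cmod (f x))\<^sup>2) summable_on UNIV"
    using assms(1) by (simp add: l2_def)
  moreover have "infsum (\<lambda>x. (cmod (f x))\<^sup>2) UNIV = 0"
    using l2_inner_self[OF assms(1)] assms(2) by (simp flip: l2_norm_power2)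
  ultimately have "(cmod (f x))\<^sup>2 = 0"
    by (intro nonneg_infsum_le_0D[where A = UNIV]) auto
  then show "f x = 0 x" by simp
qed

lemma trunc_add: "trunc E (f + g) = trunc E f + trunc E g"
  by (simp add: trunc_def fun_eq_iff distrib_left)

lemma trunc_scale: "trunc E (cscale c f) = cscale c (trunc E f)"
  by (simp add: trunc_def cscale_def fun_eq_iff)

lemma trunc_zero [simp]: "trunc E 0 = 0"
  by (simp add: trunc_def fun_eq_iff)

lemma trunc_trunc: "trunc E (trunc F f) = trunc (E \<inter> F) f"
  by (simp add: trunc_def fun_eq_iff indicator_inter_arith)

lemma trunc_sum: "trunc E (\<Sum>i\<in>I. f i) = (\<Sum>i\<in>I. trunc E (f i))"
  by (induction I rule: infinite_finite_induct) (simp_all add: trunc_add del: plus_fun_apply zero_fun_apply)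

lemma trunc_diff: "trunc E (f - g) = trunc E f - trunc E g"
  by (simp add: trunc_def fun_eq_iff right_diff_distrib)

lemma trunc_empty [simp]: "trunc {} f = 0"
  by (simp add: trunc_def fun_eq_iff)

text \<open>Truncation to \<open>E\<close> is self-adjoint: both sides are the sum over \<open>E\<close> of the same family.\<close>

lemma l2_inner_trunc: "l2_inner (trunc E f) g = l2_inner f (trunc E g)"
  unfolding l2_inner_def by (rule infsum_cong) (simp add: trunc_def indicator_def)

section \<open>Orthonormal sets\<close>

definition orthonormal :: "('a \<Rightarrow> complex) set \<Rightarrow> bool" where
  "orthonormal E \<longleftrightarrow> finite E \<and> E \<subseteq> l2
     \<and> (\<forall>e\<in>E. \<forall>e'\<in>E. l2_inner e e' = (if e = e' then 1 else 0))"

lemma orthonormal_family: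
  assumes "finite I" "\<And>i. i \<in> I \<Longrightarrow> f i \<in> l2"
    and "\<And>i j. i \<in> I \<Longrightarrow> j \<in> I \<Longrightarrow> l2_inner (f i) (f j) = (if i = j then 1 else 0)"
  shows "orthonormal (f ` I)" "inj_on f I"
proof -
  have inj: "f i = f j \<longleftrightarrow> i = j" if "i \<in> I" "j \<in> I" for i j
    using assms(3)[OF that] assms(3)[OF that(1,1)] by (metis zero_neq_one)
  then show "inj_on f I" by (auto intro: inj_onI)
  show "orthonormal (f ` I)"
    unfolding orthonormal_def using assms inj by auto
qed

lemma orthonormal_span_l2:
  assumes "orthonormal E" "f \<in> cfun.span E"
  shows "f \<in> l2"
  using subsetD[OF l2_span assms(2)] assms(1) by (simp add: orthonormal_def)

text \<open>
  Pairing with a member of an orthonormal set reads off a coefficient; independence and the Fourier expansion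
  both rest on this.
\<close>

lemma orthonormal_inner_sum:
  assumes "orthonormal E" "e \<in> E"
  shows "l2_inner (\<Sum>e'\<in>E. cscale (u e') e') e = u e"
proof -
  have "l2_inner (\<Sum>e'\<in>E. cscale (u e') e') e = (\<Sum>e'\<in>E. l2_inner (cscale (u e') e') e)"
    using assms by (intro l2_inner_sum_left l2_scale) (auto simp: orthonormal_def)
  also have "\<dots> = (\<Sum>e'\<in>E. if e' = e then u e' else 0)"
    using assms by (intro sum.cong refl, subst l2_inner_scale_left) (auto simp: orthonormal_def)
  also have "\<dots> = u e"
    using assms by (simp add: orthonormal_def sum.delta)
  finally show ?thesis .
qed

text \<open>
  The Fourier sum of \<open>f\<close> with respect to \<open>E\<close>. For orthonormal \<open>E\<close> it is the orthogonal projection onto the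
  span of \<open>E\<close>, as \<open>orth_proj_span\<close> shows.
\<close>

definition fourier_part :: "('a \<Rightarrow> complex) set \<Rightarrow> ('a \<Rightarrow> complex) \<Rightarrow> 'a \<Rightarrow> complex" where
  "fourier_part E f = (\<Sum>e\<in>E. cscale (l2_inner f e) e)"

lemma fourier_part_of_span:
  assumes E: "orthonormal E" and f: "f \<in> cfun.span E"
  shows "fourier_part E f = f"
proof -
  obtain u where u: "f = (\<Sum>e\<in>E. cscale (u e) e)"
    using f E by (auto simp: cfun.span_finite orthonormal_def)
  have "l2_inner f e = u e" if "e \<in> E" for e
    unfolding u using E that by (rule orthonormal_inner_sum)
  then have "fourier_part E f = (\<Sum>e\<in>E. cscale (u e) e)"
    unfolding fourier_part_def by (intro sum.cong) auto
  then show ?thesis by (simp only: u)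
qed

lemma orthonormal_independent:
  assumes "orthonormal E"
  shows "cfun.independent E"
proof (rule cfun.independent_if_scalars_zero)
  show "finite E" using assms by (simp add: orthonormal_def)
  fix u e assume "(\<Sum>e\<in>E. cscale (u e) e) = 0" "e \<in> E"
  then show "u e = 0"
    using orthonormal_inner_sum[OF assms, of e u] by simp
qed

lemma fourier_part_in_span: "fourier_part E f \<in> cfun.span E"
  unfolding fourier_part_def by (intro cfun.span_sum cfun.span_scale cfun.span_base)

lemma fourier_part_l2: "orthonormal E \<Longrightarrow> fourier_part E f \<in> l2"
  by (rule orthonormal_span_l2[OF _ fourier_part_in_span])

lemma fourier_part_residual_orthogonal:
  assumes E: "orthonormal E" and f: "f \<in> l2" and h: "h \<in> cfun.span E"
  shows "l2_inner (f - fourier_part E f) h = 0"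
proof -
  have El2: "e \<in> l2" if "e \<in> E" for e using E that by (auto simp: orthonormal_def)
  have r: "f - fourier_part E f \<in> l2"
    by (rule l2_diff[OF f fourier_part_l2[OF E]])
  have "l2_inner (f - fourier_part E f) e = 0" if "e \<in> E" for e
    using l2_inner_diff_left[OF f fourier_part_l2[OF E, of f] El2[OF that]]
      orthonormal_inner_sum[OF E that, of "l2_inner f"]
    by (simp only: fourier_part_def diff_self)
  then have "l2_inner (f - fourier_part E f) (cscale c e) = 0" if "e \<in> E" for c e
    using that by (simp add: l2_inner_scale_right[OF El2 r])
  then have "(\<Sum>e\<in>E. l2_inner (f - fourier_part E f) (cscale (l2_inner h e) e)) = 0"
    by (intro sum.neutral ballI)
  moreover have "l2_inner (f - fourier_part E f) (fourier_part E h)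
      = (\<Sum>e\<in>E. l2_inner (f - fourier_part E f) (cscale (l2_inner h e) e))"
    unfolding fourier_part_def[of E h] by (rule l2_inner_sum_right[OF l2_scale[OF El2] r])
  ultimately show ?thesis
    by (simp only: fourier_part_of_span[OF E h])
qed

text \<open>
  The defining property of the projection determines it uniquely: the difference of two candidates lies in the
  span and is orthogonal to the span, hence to itself.
\<close>

lemma orth_proj_span:
  assumes E: "orthonormal E" and f: "f \<in> l2"
  shows "orth_proj (cfun.span E) f = fourier_part E f"
  unfolding orth_proj_def
proof (rule the_equality)
  show "fourier_part E f \<in> cfun.span E \<and> (\<forall>h\<in>cfun.span E. l2_inner (f - fourier_part E f) h = 0)"
    by (intro conjI ballI fourier_part_in_span fourier_part_residual_orthogonal[OF E f])
next
  fix g assume g: "g \<in> cfun.span E \<and> (\<forall>h\<in>cfun.span E. l2_inner (f - g) h = 0)"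
  have gl2: "g \<in> l2" using g orthonormal_span_l2[OF E] by blast
  define d where "d = fourier_part E f - g"
  have d: "d \<in> cfun.span E" "d \<in> l2"
    unfolding d_def using g fourier_part_in_span cfun.span_diff l2_diff[OF fourier_part_l2[OF E] gl2]
    by blast+
  have "l2_inner d d = l2_inner (f - g) d - l2_inner (f - fourier_part E f) d"
    using l2_inner_diff_left[OF l2_diff[OF f gl2] l2_diff[OF f fourier_part_l2[OF E, of f]] d(2)]
    by (simp add: d_def)
  also have "\<dots> = 0"
    using g d(1) fourier_part_residual_orthogonal[OF E f] by simp
  finally show "g = fourier_part E f"
    using l2_inner_self_eq_0[OF d(2)] by (metis d_def eq_iff_diff_eq_0)
qed

text \<open>
  Pythagoras. Bessel's inequality and Parseval's identity are the cases where the left-hand side is bounded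
  below by zero and where it vanishes.
\<close>

lemma fourier_part_residual_norm:
  assumes E: "orthonormal E" and f: "f \<in> l2"
  shows "(l2_norm (f - fourier_part E f))\<^sup>2 = (l2_norm f)\<^sup>2 - (\<Sum>e\<in>E. (cmod (l2_inner f e))\<^sup>2)"
proof -
  let ?p = "fourier_part E f"
  have El2: "e \<in> l2" if "e \<in> E" for e using E that by (auto simp: orthonormal_def)
  have p: "?p \<in> l2" by (rule fourier_part_l2[OF E])
  have r: "f - ?p \<in> l2" by (rule l2_diff[OF f p])
  have "l2_inner (f - ?p) (f - ?p) = l2_inner (f - ?p) f"
    using fourier_part_residual_orthogonal[OF E f fourier_part_in_span[of E f]]
    by (simp add: l2_inner_diff_right[OF f p r])
  also have "\<dots> = l2_inner f f - l2_inner ?p f"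
    by (rule l2_inner_diff_left[OF f p f])
  also have "l2_inner ?p f = (\<Sum>e\<in>E. l2_inner (cscale (l2_inner f e) e) f)"
    unfolding fourier_part_def by (rule l2_inner_sum_left[OF _ f]) (auto intro: l2_scale El2)
  also have "\<dots> = (\<Sum>e\<in>E. complex_of_real ((cmod (l2_inner f e))\<^sup>2))"
    by (intro sum.cong refl, subst l2_inner_scale_left[OF El2 f], assumption)
      (simp only: complex_norm_square l2_inner_commute[symmetric])
  finally have "complex_of_real ((l2_norm (f - ?p))\<^sup>2)
      = complex_of_real ((l2_norm f)\<^sup>2 - (\<Sum>e\<in>E. (cmod (l2_inner f e))\<^sup>2))"
    by (simp only: l2_inner_self[OF r] l2_inner_self[OF f] of_real_diff of_real_sum)
  then show ?thesis by (simp only: of_real_eq_iff)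
qed

lemma bessel_inequality:
  assumes "orthonormal E" "f \<in> l2"
  shows "(\<Sum>e\<in>E. (cmod (l2_inner f e))\<^sup>2) \<le> (l2_norm f)\<^sup>2"
  using fourier_part_residual_norm[OF assms] zero_le_power2[of "l2_norm (f - fourier_part E f)"]
  by linarith

lemma parseval_identity:
  assumes "orthonormal E" "f \<in> cfun.span E"
  shows "(\<Sum>e\<in>E. (cmod (l2_inner f e))\<^sup>2) = (l2_norm f)\<^sup>2"
proof -
  have "f \<in> l2" by (rule orthonormal_span_l2[OF assms])
  moreover have "fourier_part E f = f"
    by (rule fourier_part_of_span[OF assms])
  ultimately show ?thesis
    using fourier_part_residual_norm[OF assms(1), of f] by (simp add: l2_norm_def)
qed

lemma normalized_l2:
  assumes "x \<in> l2" "x \<noteq> 0"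
  shows "l2_inner (cscale (complex_of_real (1 / l2_norm x)) x)
           (cscale (complex_of_real (1 / l2_norm x)) x) = 1"
proof -
  have "l2_norm x \<noteq> 0"
    using l2_inner_self[OF assms(1)] l2_inner_self_eq_0[OF assms(1)] assms(2) by auto
  then show ?thesis
    by (simp add: l2_inner_scale_left[OF assms(1) l2_scale[OF assms(1)]]
        l2_inner_scale_right[OF assms(1,1)] l2_inner_self[OF assms(1)] power2_eq_square)
qed

text \<open>
  One step of Gram-Schmidt replaces \<open>b\<close> by a multiple of \<open>b - f\<close>, where \<open>f\<close> is its projection to the span of the
  vectors already processed; only \<open>f \<in> span E\<close> matters for the span to stay the same.
\<close>

lemma span_insert_residual:
  assumes "c \<noteq> 0" "f \<in> cfun.span E"
  shows "cfun.span (insert (cscale c (b - f)) E) = cfun.span (insert b E)"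
proof (rule cfun.span_eq[THEN iffD2], intro conjI subsetI)
  fix x assume "x \<in> insert (cscale c (b - f)) E"
  moreover have "cscale c (b - f) \<in> cfun.span (insert b E)"
    by (intro cfun.span_scale cfun.span_diff cfun.span_base
        subsetD[OF cfun.span_mono assms(2)]) auto
  ultimately show "x \<in> cfun.span (insert b E)"
    by (auto intro: cfun.span_base)
next
  fix x assume "x \<in> insert b E"
  moreover have "cscale (1 / c) (cscale c (b - f)) + f \<in> cfun.span (insert (cscale c (b - f)) E)"
    by (intro cfun.span_scale cfun.span_add cfun.span_base
        subsetD[OF cfun.span_mono assms(2)]) auto
  moreover have "cscale (1 / c) (cscale c (b - f)) + f = b"
    using assms(1) by (simp add: cscale_def fun_eq_iff)
  ultimately show "x \<in> cfun.span (insert (cscale c (b - f)) E)"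
    by (auto intro: cfun.span_base)
qed

text \<open>
  Minimising the error therefore means maximising the energy of the data captured by an orthonormal basis.
\<close>

lemma approx_error_span:
  assumes "orthonormal E" "\<And>k. k < m \<Longrightarrow> a k \<in> l2"
  shows "approx_error m a (cfun.span E)
    = (\<Sum>k<m. (l2_norm (a k))\<^sup>2) - (\<Sum>e\<in>E. \<Sum>k<m. (cmod (l2_inner (a k) e))\<^sup>2)"
proof -
  have "approx_error m a (cfun.span E)
      = (\<Sum>k<m. (l2_norm (a k))\<^sup>2 - (\<Sum>e\<in>E. (cmod (l2_inner (a k) e))\<^sup>2))"
    unfolding approx_error_def
    by (intro sum.cong) (use assms in \<open>auto simp: orth_proj_span fourier_part_residual_norm\<close>)
  also have "\<dots> = (\<Sum>k<m. (l2_norm (a k))\<^sup>2) - (\<Sum>k<m. \<Sum>e\<in>E. (cmod (l2_inner (a k) e))\<^sup>2)"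
    by (simp add: sum_subtractf)
  also have "(\<Sum>k<m. \<Sum>e\<in>E. (cmod (l2_inner (a k) e))\<^sup>2) = (\<Sum>e\<in>E. \<Sum>k<m. (cmod (l2_inner (a k) e))\<^sup>2)"
    by (rule sum.swap)
  finally show ?thesis .
qed

section \<open>Orthonormal bases adapted to the partition\<close>

text \<open>
  Vectors supported in one block, in analogy with the homogeneous elements of a graded space.
\<close>

definition homogeneous :: "'n set \<Rightarrow> ('n \<Rightarrow> 'a set) \<Rightarrow> ('a \<Rightarrow> complex) \<Rightarrow> bool" where
  "homogeneous N D f \<longleftrightarrow> (\<exists>\<sigma>\<in>N. trunc (D \<sigma>) f = f)"

lemma trunc_blocks:
  assumes "disjoint_family_on D N" "\<sigma> \<in> N" "\<tau> \<in> N"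
  shows "trunc (D \<sigma>) (trunc (D \<tau>) f) = (if \<sigma> = \<tau> then trunc (D \<tau>) f else 0)"
  using disjoint_family_onD[OF assms] by (simp add: trunc_trunc)

lemma l2_inner_blocks:
  assumes "disjoint_family_on D N" "\<sigma> \<in> N" "\<tau> \<in> N" "\<sigma> \<noteq> \<tau>"
    and "trunc (D \<sigma>) f = f" "trunc (D \<tau>) g = g"
  shows "l2_inner f g = 0"
proof -
  have "l2_inner f g = l2_inner (trunc (D \<sigma>) f) (trunc (D \<tau>) g)" by (simp only: assms(5,6))
  also have "\<dots> = l2_inner f (trunc (D \<sigma>) (trunc (D \<tau>) g))" by (rule l2_inner_trunc)
  also have "\<dots> = 0" using trunc_blocks[OF assms(1-3), of g] assms(4) by simp
  finally show ?thesis .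
qed

lemma sum_trunc_partition:
  assumes "finite N" "disjoint_family_on D N" "(\<Union>\<sigma>\<in>N. D \<sigma>) = UNIV"
  shows "(\<Sum>\<sigma>\<in>N. trunc (D \<sigma>) f) = f"
proof
  fix x
  obtain \<tau> where \<tau>: "\<tau> \<in> N" "x \<in> D \<tau>" using assms(3) by blast
  have "(\<Sum>\<sigma>\<in>N. trunc (D \<sigma>) f) x = (\<Sum>\<sigma>\<in>N. trunc (D \<sigma>) f x)"
    using assms(1) by (induction N) simp_all
  also have "\<dots> = (\<Sum>\<sigma>\<in>N. if \<sigma> = \<tau> then f x else 0)"
    using \<tau> assms(2) by (intro sum.cong) (auto simp: trunc_def indicator_def disjoint_family_on_def)
  also have "\<dots> = f x" using \<tau> assms(1) by simp
  finally show "(\<Sum>\<sigma>\<in>N. trunc (D \<sigma>) f) x = f x" .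
qed

lemma orthonormal_insert:
  assumes E: "orthonormal E" and x: "x \<in> l2" "l2_inner x x = 1"
    and orth: "\<And>e. e \<in> E \<Longrightarrow> l2_inner x e = 0"
  shows "orthonormal (insert x E)"
proof -
  have "x \<notin> E" using orth[of x] x(2) by auto
  moreover have "l2_inner e x = 0" if "e \<in> E" for e
    using orth[OF that] l2_inner_commute[of e x] by simp
  ultimately show ?thesis
    using assms by (auto simp: orthonormal_def)
qed

text \<open>
  Gram-Schmidt keeps homogeneity: when \<open>b\<close> lives in the block of \<open>\<sigma>\<close>, only the basis vectors in that same block
  can have a nonzero inner product with \<open>b\<close>, so the residual of \<open>b\<close> stays in the block.
\<close>

lemma homogeneous_gram_schmidt:
  assumes disj: "disjoint_family_on D N"
    and "finite B" "B \<subseteq> l2" "\<And>b. b \<in> B \<Longrightarrow> homogeneous N D b"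
  shows "\<exists>E. orthonormal E \<and> cfun.span E = cfun.span B \<and> (\<forall>e\<in>E. homogeneous N D e)"
  using assms(2-)
proof (induction B rule: finite_induct)
  case empty
  show ?case by (rule exI[of _ "{}"]) (simp add: orthonormal_def)
next
  case (insert b B)
  then obtain E where E: "orthonormal E" "cfun.span E = cfun.span B" "\<forall>e\<in>E. homogeneous N D e"
    by auto
  have b_l2: "b \<in> l2" using insert.prems by auto
  obtain \<sigma> where \<sigma>: "\<sigma> \<in> N" "trunc (D \<sigma>) b = b"
    using insert.prems(2)[of b] by (auto simp: homogeneous_def)
  define x where "x = b - fourier_part E b"
  have fp: "fourier_part E b \<in> cfun.span E" by (rule fourier_part_in_span)
  have x_l2: "x \<in> l2" unfolding x_def by (rule l2_diff[OF b_l2 fourier_part_l2[OF E(1)]])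
  have "trunc (D \<sigma>) (cscale (l2_inner b e) e) = cscale (l2_inner b e) e" if e: "e \<in> E" for e
  proof -
    obtain \<tau> where \<tau>: "\<tau> \<in> N" "trunc (D \<tau>) e = e"
      using E(3) e by (auto simp: homogeneous_def)
    show ?thesis
    proof (cases "\<sigma> = \<tau>")
      case True
      then show ?thesis using \<tau> by (simp add: trunc_scale)
    next
      case False
      have "l2_inner b e = 0" by (rule l2_inner_blocks[OF disj \<sigma>(1) \<tau>(1) False \<sigma>(2) \<tau>(2)])
      then show ?thesis by (simp add: cscale_def trunc_def)
    qed
  qed
  then have "trunc (D \<sigma>) (fourier_part E b) = fourier_part E b"
    unfolding fourier_part_def trunc_sum by (intro sum.cong) auto
  then have x_trunc: "trunc (D \<sigma>) x = x"
    unfolding x_def trunc_diff \<sigma>(2) by (simp only:)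
  have step: "cfun.span (insert b B) = cfun.span (insert b E)"
    by (simp only: cfun.span_insert E(2))
  show ?case
  proof (cases "x = 0")
    case True
    then have "b = fourier_part E b" unfolding x_def by (simp only: right_minus_eq)
    then have "b \<in> cfun.span E" using fp by simp
    then have "cfun.span (insert b E) = cfun.span E" by (rule cfun.span_redundant)
    then show ?thesis using E step by metis
  next
    case False
    define c where "c = complex_of_real (1 / l2_norm x)"
    have one: "l2_inner (cscale c x) (cscale c x) = 1"
      unfolding c_def by (rule normalized_l2[OF x_l2 False])
    then have c0: "c \<noteq> 0" by (auto simp: cscale_def l2_inner_def)
    have "orthonormal (insert (cscale c x) E)"
    proof (rule orthonormal_insert[OF E(1) l2_scale[OF x_l2] one])
      fix e assume e: "e \<in> E"
      then have "e \<in> l2" using E(1) by (auto simp: orthonormal_def)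
      moreover have "l2_inner x e = 0"
        unfolding x_def by (rule fourier_part_residual_orthogonal[OF E(1) b_l2 cfun.span_base[OF e]])
      ultimately show "l2_inner (cscale c x) e = 0"
        by (simp add: l2_inner_scale_left[OF x_l2])
    qed
    moreover have "cfun.span (insert (cscale c x) E) = cfun.span (insert b B)"
      unfolding step x_def by (rule span_insert_residual[OF c0 fp])
    moreover have "homogeneous N D (cscale c x)"
      using \<sigma>(1) x_trunc by (auto simp: homogeneous_def trunc_scale)
    ultimately show ?thesis using E(3) by blast
  qed
qed

text \<open>
  The truncations of a finite spanning set of \<open>S\<close> again lie in \<open>S\<close> and again span it, since every vector is the
  sum of its truncations. They are homogeneous, so Gram-Schmidt can start from them.
\<close>

lemma adapted_orthonormal_basis:
  assumes "finite N" "disjoint_family_on D N" "(\<Union>\<sigma>\<in>N. D \<sigma>) = UNIV"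
    and S: "S \<in> subspace_class N D l"
  shows "\<exists>E. orthonormal E \<and> cfun.span E = S \<and> card E \<le> l \<and> (\<forall>e\<in>E. homogeneous N D e)"
proof -
  obtain B where B: "finite B" "cfun.span B = S" and S_l2: "S \<subseteq> l2"
    and dim: "cfun.dim S \<le> l" and inv: "\<And>\<sigma> f. \<sigma> \<in> N \<Longrightarrow> f \<in> S \<Longrightarrow> trunc (D \<sigma>) f \<in> S"
    using S unfolding subspace_class_def by blast
  define B' where "B' = (\<lambda>(\<sigma>, b). trunc (D \<sigma>) b) ` (N \<times> B)"
  have BS: "b \<in> S" if "b \<in> B" for b using B(2) cfun.span_base[OF that] by simp
  have B'S: "B' \<subseteq> S" unfolding B'_def using inv BS by auto
  have "\<exists>E. orthonormal E \<and> cfun.span E = cfun.span B' \<and> (\<forall>e\<in>E. homogeneous N D e)"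
  proof (rule homogeneous_gram_schmidt[OF assms(2)])
    show "finite B'" using assms(1) B(1) by (simp add: B'_def)
    show "B' \<subseteq> l2" using B'S S_l2 by blast
    show "homogeneous N D b" if b: "b \<in> B'" for b
    proof -
      obtain \<sigma> b' where "\<sigma> \<in> N" "b = trunc (D \<sigma>) b'"
        using b by (auto simp: B'_def)
      then have "trunc (D \<sigma>) b = b" by (simp add: trunc_trunc)
      then show ?thesis using \<open>\<sigma> \<in> N\<close> by (auto simp: homogeneous_def)
    qed
  qed
  then obtain E where E: "orthonormal E" "cfun.span E = cfun.span B'" "\<forall>e\<in>E. homogeneous N D e"
    by blast
  have "cfun.span B' = S"
  proof
    show "cfun.span B' \<subseteq> S"
      using B'S cfun.span_minimal[of B' S] B(2) cfun.subspace_span by metis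
    have "b \<in> cfun.span B'" if "b \<in> B" for b
    proof -
      have "(\<Sum>\<sigma>\<in>N. trunc (D \<sigma>) b) \<in> cfun.span B'"
        by (intro cfun.span_sum cfun.span_base) (use that in \<open>auto simp: B'_def\<close>)
      then show ?thesis by (simp only: sum_trunc_partition[OF assms(1-3)])
    qed
    then show "S \<subseteq> cfun.span B'"
      using B(2) cfun.span_minimal[of B "cfun.span B'"] cfun.subspace_span by blast
  qed
  then have "cfun.span E = S" using E(2) by simp
  moreover have "card E \<le> l"
    using dim cfun.dim_span_eq_card_independent[OF orthonormal_independent[OF E(1)]] calculation
    by simp
  ultimately show ?thesis using E by blast
qed

section \<open>The spectral theorem for Hermitian matrices\<close>

text \<open>
  Gram-Schmidt applied to a flag \<open>p 0, p 1, \<dots>\<close> that \<open>T\<close> maps triangularly yields eigenvectors. Let \<open>x\<close> be the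
  residual of \<open>p k\<close> and \<open>E\<close> the eigenvectors found before. The triangular shape puts \<open>T x - b k * x\<close> into the
  span of \<open>E\<close>; symmetry of \<open>T\<close> and \<open>T\<close>-invariance of that span make it orthogonal to the span. Hence it
  vanishes. The eigenvalue is the diagonal entry \<open>b k\<close>, so the order of the diagonal is preserved.
\<close>

lemma symmetric_triangular_imp_diagonal:
  fixes T :: "('a \<Rightarrow> complex) \<Rightarrow> 'a \<Rightarrow> complex" and n :: nat
  assumes T_add: "\<And>f g. T (f + g) = T f + T g"
    and T_scale: "\<And>c f. T (cscale c f) = cscale c (T f)"
    and T_sym: "\<And>f g. l2_inner (T f) g = l2_inner f (T g)"
    and p_l2: "\<And>j. j < n \<Longrightarrow> p j \<in> l2"
    and p_indep: "\<And>k. k < n \<Longrightarrow> p k \<notin> cfun.span (p ` {..<k})"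
    and T_p: "\<And>k. k < n \<Longrightarrow> T (p k) - cscale (b k) (p k) \<in> cfun.span (p ` {..<k})"
  shows "\<exists>e. (\<forall>i<n. e i \<in> cfun.span (p ` {..<n}) \<and> T (e i) = cscale (b i) (e i))
    \<and> (\<forall>i<n. \<forall>j<n. l2_inner (e i) (e j) = (if i = j then 1 else 0))"
proof -
  have T_diff: "T (f - g) = T f - T g" for f g
    using T_add[of "f - g" g] by (simp add: algebra_simps del: plus_fun_apply minus_apply)
  have "k \<le> n \<Longrightarrow> \<exists>e. (\<forall>i<k. T (e i) = cscale (b i) (e i))
    \<and> (\<forall>i<k. \<forall>j<k. l2_inner (e i) (e j) = (if i = j then 1 else 0))
    \<and> cfun.span (e ` {..<k}) = cfun.span (p ` {..<k})" for k
  proof (induction k)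
    case 0
    show ?case by simp
  next
    case (Suc k)
    then obtain e where e: "\<And>i. i < k \<Longrightarrow> T (e i) = cscale (b i) (e i)"
      "\<And>i j. i < k \<Longrightarrow> j < k \<Longrightarrow> l2_inner (e i) (e j) = (if i = j then 1 else 0)"
      and sp: "cfun.span (e ` {..<k}) = cfun.span (p ` {..<k})"
      by auto
    let ?E = "e ` {..<k}"
    have k: "k < n" using Suc.prems by simp
    have span_l2: "cfun.span (p ` {..<k}) \<subseteq> l2"
      by (rule l2_span) (use p_l2 k in auto)
    have e_l2: "e i \<in> l2" if "i < k" for i
      using span_l2 cfun.span_base[of "e i" ?E] that sp by auto
    have E: "orthonormal ?E"
      by (rule orthonormal_family) (use e_l2 e(2) in auto)
    define x where "x = p k - fourier_part ?E (p k)"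
    have x_l2: "x \<in> l2"
      unfolding x_def by (intro l2_diff p_l2 k fourier_part_l2 E)
    have fp: "fourier_part ?E (p k) \<in> cfun.span ?E" by (rule fourier_part_in_span)
    have x0: "x \<noteq> 0"
    proof
      assume "x = 0"
      then have "p k = fourier_part ?E (p k)"
        unfolding x_def by (simp only: right_minus_eq)
      then show False using fp sp p_indep[OF k] by metis
    qed
    have x_orth: "l2_inner x h = 0" if "h \<in> cfun.span ?E" for h
      unfolding x_def by (rule fourier_part_residual_orthogonal[OF E p_l2[OF k] that])
    have T_span: "T h \<in> cfun.span ?E" if "h \<in> cfun.span ?E" for h
      using that
    proof (induction rule: cfun.span_induct_alt)
      case base
      have "T 0 = 0" using T_scale[of 0 0] by (simp only: cfun.scale_zero_left)
      then show ?case by (simp only: cfun.span_zero)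
    next
      case (step c f g)
      then obtain i where i: "i < k" "f = e i" by auto
      have "T f \<in> cfun.span ?E"
        unfolding i e(1)[OF i(1)] by (intro cfun.span_scale cfun.span_base) (use i in auto)
      then show ?case
        unfolding T_add T_scale by (intro cfun.span_add cfun.span_scale step)
    qed
    define d where "d = T x - cscale (b k) x"
    have "d = (T (p k) - cscale (b k) (p k))
        - (T (fourier_part ?E (p k)) - cscale (b k) (fourier_part ?E (p k)))"
      unfolding d_def x_def T_diff cfun.scale_right_diff_distrib by (simp only: algebra_simps)
    moreover have "T (p k) - cscale (b k) (p k) \<in> cfun.span ?E"
      using T_p[OF k] sp by simp
    ultimately have d: "d \<in> cfun.span ?E"
      by (simp only: cfun.span_diff cfun.span_scale T_span fp)
    then have d_l2: "d \<in> l2" using span_l2 sp by auto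
    have Tx_l2: "T x \<in> l2"
    proof -
      have "T x = d + cscale (b k) x" unfolding d_def by (simp only: diff_add_cancel)
      then show ?thesis using l2_add[OF d_l2 l2_scale[OF x_l2]] by simp
    qed
    have "l2_inner d d = l2_inner (T x) d - b k * l2_inner x d"
      using l2_inner_diff_left[OF Tx_l2 l2_scale[OF x_l2] d_l2, of "b k"]
        l2_inner_scale_left[OF x_l2 d_l2, of "b k"]
      by (simp only: d_def)
    also have "\<dots> = 0"
      unfolding T_sym x_orth[OF T_span[OF d]] x_orth[OF d] by simp
    finally have "d = 0" by (rule l2_inner_self_eq_0[OF d_l2])
    then have Tx: "T x = cscale (b k) x"
      unfolding d_def by (simp only: right_minus_eq)
    define c where "c = complex_of_real (1 / l2_norm x)"
    define e' where "e' = e(k := cscale c x)"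
    have lt: "i < Suc k \<longleftrightarrow> i < k \<or> i = k" for i by auto
    have "T (cscale c x) = cscale (b k) (cscale c x)"
      by (simp only: T_scale Tx cfun.scale_scale mult.commute)
    then have eig: "T (e' i) = cscale (b i) (e' i)" if "i < Suc k" for i
      using that e(1)[of i] by (auto simp: e'_def lt)
    have xe: "l2_inner (cscale c x) (e i) = 0" if "i < k" for i
      using x_orth[of "e i"] cfun.span_base[of "e i" ?E] that
      by (simp add: l2_inner_scale_left[OF x_l2 e_l2])
    have ex: "l2_inner (e i) (cscale c x) = 0" if "i < k" for i
      using xe[OF that] l2_inner_commute[of "e i"] by simp
    have orth: "l2_inner (e' i) (e' j) = (if i = j then 1 else 0)" if "i < Suc k" "j < Suc k" for i j
      using that e(2)[of i j] xe[of j] ex[of i] normalized_l2[OF x_l2 x0]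
      unfolding lt by (auto simp: e'_def c_def)
    have c0: "c \<noteq> 0"
      using normalized_l2[OF x_l2 x0] by (auto simp: c_def cscale_def l2_inner_def)
    have img: "e' ` {..<Suc k} = insert (cscale c x) ?E"
      by (auto simp: e'_def lessThan_Suc)
    have "cfun.span (e' ` {..<Suc k}) = cfun.span (insert (p k) ?E)"
      unfolding img x_def by (rule span_insert_residual[OF c0 fp])
    also have "\<dots> = cfun.span (insert (p k) (p ` {..<k}))"
      by (simp only: cfun.span_insert sp)
    also have "insert (p k) (p ` {..<k}) = p ` {..<Suc k}"
      by (auto simp: lessThan_Suc)
    finally have "cfun.span (e' ` {..<Suc k}) = cfun.span (p ` {..<Suc k})" .
    then show ?case using eig orth by blast
  qed
  from this[of n] obtain e where e: "\<forall>i<n. T (e i) = cscale (b i) (e i)"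
    "\<forall>i<n. \<forall>j<n. l2_inner (e i) (e j) = (if i = j then 1 else 0)"
    "cfun.span (e ` {..<n}) = cfun.span (p ` {..<n})" by auto
  have "e i \<in> cfun.span (p ` {..<n})" if "i < n" for i
    using cfun.span_base[of "e i" "e ` {..<n}"] that e(3) by auto
  then show ?thesis using e(1,2) by blast
qed

text \<open>
  Vectors of \<open>\<complex>\<^sup>n\<close> are embedded as functions on \<open>nat\<close> that vanish outside \<open>{..<n}\<close>; this lemma and the next one make the
  theory of orthonormal sets available for them.
\<close>

lemma l2_finite_support:
  assumes "finite S" "\<And>x. x \<notin> S \<Longrightarrow> f x = 0"
  shows "f \<in> l2"
proof -
  have "(\<lambda>x. (cmod (f x))\<^sup>2) summable_on S" using assms(1) by simp
  then have "(\<lambda>x. (cmod (f x))\<^sup>2) summable_on UNIV"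
    by (rule summable_on_cong_neutral[THEN iffD1, rotated -1]) (use assms(2) in auto)
  then show ?thesis by (simp add: l2_def)
qed

lemma l2_inner_finite_support:
  assumes "finite S" "\<And>x. x \<notin> S \<Longrightarrow> f x * cnj (g x) = 0"
  shows "l2_inner f g = (\<Sum>x\<in>S. f x * cnj (g x))"
proof -
  have "l2_inner f g = (\<Sum>\<^sub>\<infinity>x\<in>S. f x * cnj (g x))"
    unfolding l2_inner_def by (rule infsum_cong_neutral) (use assms(2) in auto)
  then show ?thesis using assms(1) by simp
qed

text \<open>
  Schur's decomposition \<open>A = P B Q\<close> says that \<open>A\<close> acts triangularly on the columns of \<open>P\<close>, with the prescribed list
  \<open>es\<close> on the diagonal. Its matrix \<open>P\<close> need not be unitary; \<open>symmetric_triangular_imp_diagonal\<close> supplies the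
  orthonormalisation.
\<close>

lemma hermitian_eigenbasis:
  fixes A :: "complex mat"
  assumes A: "A \<in> carrier_mat n n"
    and herm: "\<And>r s. r < n \<Longrightarrow> s < n \<Longrightarrow> A $$ (r, s) = cnj (A $$ (s, r))"
    and cp: "char_poly A = (\<Prod>e\<leftarrow>es. [:- e, 1:])" and len: "length es = n"
  shows "\<exists>y. (\<forall>j<n. y j \<in> carrier_vec n \<and> A *\<^sub>v y j = es ! j \<cdot>\<^sub>v y j \<and> es ! j \<in> \<real>)
    \<and> (\<forall>i<n. \<forall>j<n. y i \<bullet>c y j = (if i = j then 1 else 0))"
proof -
  obtain B P Q where schur: "schur_decomposition A es = (B, P, Q)" by (cases "schur_decomposition A es")
  from schur_decomposition[OF A cp schur]
  have sim: "similar_mat_wit A B P Q" and ut: "upper_triangular B" and diag: "diag_mat B = es" by auto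
  from sim A have B: "B \<in> carrier_mat n n" and P: "P \<in> carrier_mat n n" and Q: "Q \<in> carrier_mat n n"
    and QP: "Q * P = 1\<^sub>m n" and APBQ: "A = P * B * Q"
    by (auto simp: similar_mat_wit_def Let_def)
  have AP: "A * P = P * B"
    unfolding APBQ using B P Q QP by (metis assoc_mult_mat mult_carrier_mat right_mult_one_mat)
  have bk: "B $$ (k, k) = es ! k" if "k < n" for k
    using diag that B unfolding diag_mat_def by auto
  define T where "T = (\<lambda>(f::nat \<Rightarrow> complex) r. if r < n then \<Sum>s<n. A $$ (r, s) * f s else 0)"
  define p where "p = (\<lambda>j r. if r < n then P $$ (r, j) else 0)"
  have p_l2: "p j \<in> l2" for j
    by (rule l2_finite_support[of "{..<n}"]) (auto simp: p_def)
  have T_sym: "l2_inner (T f) g = l2_inner f (T g)" for f g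
  proof -
    have "l2_inner (T f) g = (\<Sum>r<n. \<Sum>s<n. A $$ (r, s) * f s * cnj (g r))"
      by (subst l2_inner_finite_support[of "{..<n}"]) (auto simp: T_def sum_distrib_right)
    also have "\<dots> = (\<Sum>s<n. \<Sum>r<n. A $$ (r, s) * f s * cnj (g r))" by (rule sum.swap)
    also have "\<dots> = (\<Sum>s<n. \<Sum>r<n. f s * cnj (A $$ (s, r) * g r))"
      by (intro sum.cong refl; subst herm; simp add: mult_ac)
    also have "\<dots> = l2_inner f (T g)"
      by (subst l2_inner_finite_support[of "{..<n}"])
        (auto simp: T_def sum_distrib_left cnj_sum)
    finally show ?thesis .
  qed
  have "\<exists>e. (\<forall>i<n. e i \<in> cfun.span (p ` {..<n}) \<and> T (e i) = cscale (es ! i) (e i))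
    \<and> (\<forall>i<n. \<forall>j<n. l2_inner (e i) (e j) = (if i = j then 1 else 0))"
  proof (rule symmetric_triangular_imp_diagonal)
    show "T (f + g) = T f + T g" for f g
      by (auto simp: T_def fun_eq_iff distrib_left sum.distrib)
    show "T (cscale c f) = cscale c (T f)" for c f
      by (auto simp: T_def cscale_def fun_eq_iff sum_distrib_left mult_ac)
    fix k assume k: "k < n"
    \<comment> \<open>The coordinate functional of \<open>p k\<close>, read off from \<open>Q\<close>, the inverse of \<open>P\<close>. It kills the earlier columns, which shows independence.\<close>
    define phi where "phi = (\<lambda>f. \<Sum>r<n. Q $$ (k, r) * f r)"
    have phi_p: "phi (p j) = (if j = k then 1 else 0)" if "j < n" for j
    proof -
      have "(Q * P) $$ (k, j) = (\<Sum>r<n. Q $$ (k, r) * P $$ (r, j))"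
        using P Q k that by (simp add: scalar_prod_def lessThan_atLeast0)
      then have "(\<Sum>r<n. Q $$ (k, r) * P $$ (r, j)) = (if j = k then 1 else 0)"
        using k that by (auto simp: QP)
      then show ?thesis by (simp add: phi_def p_def)
    qed
    have "cfun.subspace {f. phi f = 0}"
      by (rule cfun.subspaceI)
        (auto simp: phi_def cscale_def distrib_left sum.distrib mult.left_commute
          simp flip: sum_distrib_left)
    then have "cfun.span (p ` {..<k}) \<subseteq> {f. phi f = 0}"
      by (intro cfun.span_minimal) (use k phi_p in auto)
    then show "p k \<notin> cfun.span (p ` {..<k})"
      using phi_p[OF k] by auto
    have "T (p k) = (\<Sum>j<n. cscale (B $$ (j, k)) (p j))"
    proof
      fix r
      have "(A * P) $$ (r, k) = (\<Sum>s<n. A $$ (r, s) * P $$ (s, k))" if "r < n"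
        using A P k that by (simp add: scalar_prod_def lessThan_atLeast0)
      moreover have "(P * B) $$ (r, k) = (\<Sum>s<n. P $$ (r, s) * B $$ (s, k))" if "r < n"
        using B P k that by (simp add: scalar_prod_def lessThan_atLeast0)
      moreover have "(\<Sum>j<n. cscale (B $$ (j, k)) (p j)) r = (\<Sum>j<n. B $$ (j, k) * p j r)"
        by (induction n) (simp_all add: cscale_def)
      ultimately show "T (p k) r = (\<Sum>j<n. cscale (B $$ (j, k)) (p j)) r"
        using AP by (simp add: T_def p_def mult.commute)
    qed
    also have "\<dots> = (\<Sum>j<Suc k. cscale (B $$ (j, k)) (p j))"
      by (rule sum.mono_neutral_right)
        (use k ut B in \<open>auto simp: upper_triangular_def cscale_def fun_eq_iff\<close>)
    also have "\<dots> = (\<Sum>j<k. cscale (B $$ (j, k)) (p j)) + cscale (es ! k) (p k)"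
      by (simp only: sum.lessThan_Suc bk[OF k])
    finally have "T (p k) - cscale (es ! k) (p k) = (\<Sum>j<k. cscale (B $$ (j, k)) (p j))"
      by (simp only: add_diff_cancel_right')
    also have "\<dots> \<in> cfun.span (p ` {..<k})"
      by (intro cfun.span_sum cfun.span_scale cfun.span_base) auto
    finally show "T (p k) - cscale (es ! k) (p k) \<in> cfun.span (p ` {..<k})" .
  qed (use T_sym p_l2 in auto)
  then obtain e where e_span: "\<And>i. i < n \<Longrightarrow> e i \<in> cfun.span (p ` {..<n})"
    and Te: "\<And>i. i < n \<Longrightarrow> T (e i) = cscale (es ! i) (e i)"
    and orth: "\<And>i j. i < n \<Longrightarrow> j < n \<Longrightarrow> l2_inner (e i) (e j) = (if i = j then 1 else 0)"
    by blast
  have "cfun.subspace {f. \<forall>r\<ge>n. f r = 0}"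
    by (rule cfun.subspaceI) (auto simp: cscale_def)
  then have "cfun.span (p ` {..<n}) \<subseteq> {f. \<forall>r\<ge>n. f r = 0}"
    by (rule cfun.span_minimal[rotated]) (auto simp: p_def)
  then have supp: "e i r = 0" if "i < n" "r \<ge> n" for i r
    using e_span that by blast
  have e_l2: "e i \<in> l2" if "i < n" for i
    by (rule l2_finite_support[of "{..<n}"]) (use supp that in auto)
  have real: "es ! i \<in> \<real>" if "i < n" for i
  proof -
    have "es ! i = l2_inner (T (e i)) (e i)"
      unfolding Te[OF that] using orth[OF that that]
      by (simp add: l2_inner_scale_left[OF e_l2[OF that] e_l2[OF that]])
    also have "\<dots> = l2_inner (e i) (T (e i))" by (rule T_sym)
    also have "\<dots> = cnj (es ! i)"
      unfolding Te[OF that] using orth[OF that that]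
      by (simp add: l2_inner_scale_right[OF e_l2[OF that] e_l2[OF that]])
    finally show ?thesis by (simp add: Reals_cnj_iff)
  qed
  have "A *\<^sub>v vec n (e j) = es ! j \<cdot>\<^sub>v vec n (e j)" if "j < n" for j
  proof (rule eq_vecI)
    fix r assume "r < dim_vec (es ! j \<cdot>\<^sub>v vec n (e j))"
    then have r: "r < n" by simp
    have "(A *\<^sub>v vec n (e j)) $ r = T (e j) r"
      using A r by (simp add: scalar_prod_def lessThan_atLeast0 T_def)
    then show "(A *\<^sub>v vec n (e j)) $ r = (es ! j \<cdot>\<^sub>v vec n (e j)) $ r"
      using r by (simp add: Te[OF that] cscale_def)
  qed (use A in auto)
  moreover have "vec n (e i) \<bullet>c vec n (e j) = (if i = j then 1 else 0)" if "i < n" "j < n" for i j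
  proof -
    have "l2_inner (e i) (e j) = (\<Sum>r<n. e i r * cnj (e j r))"
      by (rule l2_inner_finite_support) (use supp that in auto)
    then show ?thesis
      using orth[OF that] by (simp add: scalar_prod_def lessThan_atLeast0)
  qed
  ultimately show ?thesis using real by (intro exI[of _ "\<lambda>j. vec n (e j)"]) auto
qed

text \<open>
  Left eigenvectors of \<open>G\<close> are eigenvectors of its transpose. Sorting the roots of the characteristic polynomial
  before the decomposition yields decreasing eigenvalues; the roots are sorted by real part because that they
  are real is known only afterwards.
\<close>

lemma left_eigensystem_exists:
  assumes G: "G \<in> carrier_mat m m"
    and herm: "\<And>r s. r < m \<Longrightarrow> s < m \<Longrightarrow> G $$ (r, s) = cnj (G $$ (s, r))"
  shows "\<exists>lam y. left_eigensystem m G lam y"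
proof -
  obtain es0 where es0: "char_poly G = (\<Prod>e\<leftarrow>es0. [:- e, 1:])" "length es0 = m"
    using char_poly_factorized[OF G] by blast
  define es where "es = rev (sort_key Re es0)"
  have len: "length es = m" by (simp add: es_def es0(2))
  have cp: "char_poly G = (\<Prod>e\<leftarrow>es. [:- e, 1:])"
    unfolding es0(1) es_def by (simp flip: prod_mset_prod_list add: mset_map)
  have decr: "Re (es ! j) \<le> Re (es ! i)" if "i \<le> j" "j < m" for i j
  proof -
    have "sorted (map Re (sort_key Re es0))" by simp
    then have "Re (sort_key Re es0 ! (m - Suc j)) \<le> Re (sort_key Re es0 ! (m - Suc i))"
      using that es0(2) by (auto simp: sorted_iff_nth_mono)
    then show ?thesis using that es0(2) by (simp add: es_def rev_nth)
  qed
  have "\<exists>y. (\<forall>j<m. y j \<in> carrier_vec m \<and> G\<^sup>T *\<^sub>v y j = es ! j \<cdot>\<^sub>v y j \<and> es ! j \<in> \<real>)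
    \<and> (\<forall>i<m. \<forall>j<m. y i \<bullet>c y j = (if i = j then 1 else 0))"
  proof (rule hermitian_eigenbasis)
    show "G\<^sup>T \<in> carrier_mat m m" using G by simp
    show "G\<^sup>T $$ (r, s) = cnj (G\<^sup>T $$ (s, r))" if "r < m" "s < m" for r s
      using G herm[OF that(2,1)] that by auto
    show "char_poly G\<^sup>T = (\<Prod>e\<leftarrow>es. [:- e, 1:])" using G cp by simp
  qed (rule len)
  then obtain y where y: "\<forall>j<m. y j \<in> carrier_vec m \<and> G\<^sup>T *\<^sub>v y j = es ! j \<cdot>\<^sub>v y j \<and> es ! j \<in> \<real>"
    "\<forall>i<m. \<forall>j<m. y i \<bullet>c y j = (if i = j then 1 else 0)" by blast
  have real: "complex_of_real (Re (es ! j)) = es ! j" if "j < m" for j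
    using y(1) that by (simp add: of_real_Re)
  have "char_poly G = (\<Prod>j<m. [:- complex_of_real (Re (es ! j)), 1:])"
    unfolding cp prod.list_conv_set_nth
    by (simp add: len lessThan_atLeast0 real)
  then have "left_eigensystem m G (\<lambda>j. Re (es ! j)) y"
    unfolding left_eigensystem_def using y decr real by auto
  then show ?thesis by blast
qed

section \<open>Diagonalising a Gramian\<close>

text \<open>
  A square matrix with orthonormal rows has orthonormal columns, and hence preserves the Euclidean norm.
\<close>

lemma orthonormal_rows_parseval:
  assumes y: "\<And>j. j < m \<Longrightarrow> y j \<in> carrier_vec m"
    and orth: "\<And>i j. i < m \<Longrightarrow> j < m \<Longrightarrow> y i \<bullet>c y j = (if i = j then 1 else (0::complex))"
  shows "(\<Sum>j<m. (cmod (\<Sum>k<m. y j $ k * z k))\<^sup>2) = (\<Sum>k<m. (cmod (z k))\<^sup>2)"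
proof -
  define U where "U = mat m m (\<lambda>(j, k). y j $ k)"
  define V where "V = mat m m (\<lambda>(k, j). cnj (y j $ k))"
  have "U * V = 1\<^sub>m m"
  proof (rule eq_matI)
    fix i j assume "i < dim_row (1\<^sub>m m)" "j < dim_col (1\<^sub>m m)"
    then have ij: "i < m" "j < m" by auto
    then have "(U * V) $$ (i, j) = y i \<bullet>c y j"
      using y[OF ij(1)] y[OF ij(2)] by (auto simp: U_def V_def scalar_prod_def intro!: sum.cong)
    then show "(U * V) $$ (i, j) = 1\<^sub>m m $$ (i, j)" using orth[OF ij] ij by simp
  qed (auto simp: U_def V_def)
  then have VU: "V * U = 1\<^sub>m m"
    by (rule mat_mult_left_right_inverse[rotated -1]) (auto simp: U_def V_def)
  have col: "(\<Sum>j<m. y j $ k * cnj (y j $ k')) = (if k = k' then 1 else 0)" if "k < m" "k' < m" for k k'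
  proof -
    have "(V * U) $$ (k', k) = (\<Sum>j<m. y j $ k * cnj (y j $ k'))"
      using that by (simp add: U_def V_def scalar_prod_def lessThan_atLeast0 mult.commute)
    then show ?thesis using that by (auto simp: VU)
  qed
  have "(\<Sum>j<m. (\<Sum>k<m. y j $ k * z k) * cnj (\<Sum>k<m. y j $ k * z k))
      = (\<Sum>j<m. \<Sum>k<m. \<Sum>k'<m. z k * cnj (z k') * (y j $ k * cnj (y j $ k')))"
    by (simp add: sum_product cnj_sum mult_ac)
  also have "\<dots> = (\<Sum>k<m. \<Sum>j<m. \<Sum>k'<m. z k * cnj (z k') * (y j $ k * cnj (y j $ k')))"
    by (rule sum.swap)
  also have "\<dots> = (\<Sum>k<m. \<Sum>k'<m. \<Sum>j<m. z k * cnj (z k') * (y j $ k * cnj (y j $ k')))"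
    by (intro sum.cong refl sum.swap)
  also have "\<dots> = (\<Sum>k<m. \<Sum>k'<m. if k = k' then z k * cnj (z k') else 0)"
    by (intro sum.cong refl) (simp add: col flip: sum_distrib_left)
  also have "\<dots> = (\<Sum>k<m. z k * cnj (z k))" by simp
  finally have "complex_of_real (\<Sum>j<m. (cmod (\<Sum>k<m. y j $ k * z k))\<^sup>2)
      = complex_of_real (\<Sum>k<m. (cmod (z k))\<^sup>2)"
    by (simp only: of_real_sum complex_norm_square)
  then show ?thesis by (simp only: of_real_eq_iff)
qed

definition eigencombination :: "nat \<Rightarrow> (nat \<Rightarrow> 'a \<Rightarrow> complex) \<Rightarrow> complex vec \<Rightarrow> 'a \<Rightarrow> complex" where
  "eigencombination m b w = (\<Sum>k<m. cscale (w $ k) (b k))"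

lemma eigencombination_l2: "(\<And>k. k < m \<Longrightarrow> b k \<in> l2) \<Longrightarrow> eigencombination m b w \<in> l2"
  unfolding eigencombination_def by (intro l2_sum l2_scale) auto

lemma l2_inner_eigencombination:
  assumes "\<And>k. k < m \<Longrightarrow> b k \<in> l2" "h \<in> l2"
  shows "l2_inner (eigencombination m b w) h = (\<Sum>k<m. w $ k * l2_inner (b k) h)"
proof -
  have "l2_inner (eigencombination m b w) h = (\<Sum>k<m. l2_inner (cscale (w $ k) (b k)) h)"
    unfolding eigencombination_def by (rule l2_inner_sum_left) (use assms l2_scale in auto)
  then show ?thesis using assms by (simp add: l2_inner_scale_left)
qed

text \<open>
  The Gramian of the combinations is \<open>Y G Y\<^sup>*\<close>, where the rows of \<open>Y\<close> are the \<open>y j\<close>, and this is diagonal because these rows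
  are orthonormal left eigenvectors of \<open>G\<close>.
\<close>

lemma eigencombinations_orthogonal:
  assumes b: "\<And>k. k < m \<Longrightarrow> b k \<in> l2"
    and es: "left_eigensystem m (gramian m b) lam y"
    and ij: "i < m" "j < m"
  shows "l2_inner (eigencombination m b (y i)) (eigencombination m b (y j))
    = (if i = j then complex_of_real (lam i) else 0)"
proof -
  let ?G = "gramian m b"
  let ?v = "\<lambda>j. eigencombination m b (y j)"
  have y: "y i \<in> carrier_vec m" "y j \<in> carrier_vec m"
    and eig: "?G\<^sup>T *\<^sub>v y i = complex_of_real (lam i) \<cdot>\<^sub>v y i"
    and orth: "y i \<bullet>c y j = (if i = j then 1 else 0)"
    using es ij unfolding left_eigensystem_def by blast+
  have G: "(\<Sum>k<m. y i $ k * l2_inner (b k) (b r)) = complex_of_real (lam i) * y i $ r" if r: "r < m" for r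
  proof -
    have "(?G\<^sup>T *\<^sub>v y i) $ r = (\<Sum>k<m. y i $ k * l2_inner (b k) (b r))"
      using r y by (simp add: gramian_def scalar_prod_def lessThan_atLeast0 mult.commute)
    then show ?thesis using eig r y by simp
  qed
  have "l2_inner (?v i) (?v j) = (\<Sum>r<m. cnj (y j $ r) * l2_inner (?v i) (b r))"
  proof -
    have "l2_inner (?v i) (?v j) = (\<Sum>r<m. l2_inner (?v i) (cscale (y j $ r) (b r)))"
      unfolding eigencombination_def[of m b "y j"]
      by (rule l2_inner_sum_right) (use b l2_scale eigencombination_l2[of m b] in auto)
    then show ?thesis
      using b eigencombination_l2[of m b] by (simp add: l2_inner_scale_right)
  qed
  also have "\<dots> = (\<Sum>r<m. cnj (y j $ r) * (complex_of_real (lam i) * y i $ r))"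
    by (intro sum.cong refl) (use b G l2_inner_eigencombination[of m b] in simp)
  also have "\<dots> = complex_of_real (lam i) * (y i \<bullet>c y j)"
    using y by (simp add: scalar_prod_def lessThan_atLeast0 sum_distrib_left mult_ac)
  finally show ?thesis using orth by simp
qed

text \<open>
  Unitarity of the coefficient matrix, applied to the vector of inner products with \<open>h\<close>.
\<close>

lemma eigencombinations_capture:
  assumes b: "\<And>k. k < m \<Longrightarrow> b k \<in> l2"
    and es: "left_eigensystem m G lam y" and h: "h \<in> l2"
  shows "(\<Sum>j<m. (cmod (l2_inner (eigencombination m b (y j)) h))\<^sup>2) = (\<Sum>k<m. (cmod (l2_inner (b k) h))\<^sup>2)"
proof -
  have "l2_inner (eigencombination m b w) h = (\<Sum>k<m. w $ k * l2_inner (b k) h)" for w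
    by (rule l2_inner_eigencombination) (use b h in auto)
  then show ?thesis
    using orthonormal_rows_parseval[of m y "\<lambda>k. l2_inner (b k) h"] es
    by (auto simp: left_eigensystem_def)
qed

text \<open>
  Unitarity holds at every point \<open>x\<close>, for the vector of values at \<open>x\<close>; summing over \<open>x\<close> gives the norms.
\<close>

lemma eigencombinations_total_norm:
  assumes b: "\<And>k. k < m \<Longrightarrow> b k \<in> l2"
    and es: "left_eigensystem m G lam y"
  shows "(\<Sum>j<m. (l2_norm (eigencombination m b (y j)))\<^sup>2) = (\<Sum>k<m. (l2_norm (b k))\<^sup>2)"
proof -
  have pointwise: "(\<Sum>j<m. (cmod (eigencombination m b (y j) x))\<^sup>2) = (\<Sum>k<m. (cmod (b k x))\<^sup>2)" for x
  proof -
    have "eigencombination m b w x = (\<Sum>k<m. w $ k * b k x)" for w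
      unfolding eigencombination_def by (induction m) (simp_all add: cscale_def)
    then show ?thesis
      using orthonormal_rows_parseval[of m y "\<lambda>k. b k x"] es
      by (auto simp: left_eigensystem_def)
  qed
  have swap: "(\<Sum>j<m. (l2_norm (f j))\<^sup>2) = (\<Sum>\<^sub>\<infinity>x. \<Sum>j<m. (cmod (f j x))\<^sup>2)"
    if "\<And>j. j < m \<Longrightarrow> f j \<in> l2" for f :: "nat \<Rightarrow> 'a \<Rightarrow> complex"
  proof -
    have "((\<lambda>x. \<Sum>j<k. (cmod (f j x))\<^sup>2) has_sum (\<Sum>j<k. (l2_norm (f j))\<^sup>2)) UNIV" if "k \<le> m" for k
      using that
    proof (induction k)
      case (Suc k)
      then have "f k \<in> l2" using \<open>\<And>j. j < m \<Longrightarrow> f j \<in> l2\<close> by simp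
      then have "((\<lambda>x. (cmod (f k x))\<^sup>2) has_sum (l2_norm (f k))\<^sup>2) UNIV"
        unfolding l2_norm_power2 by (intro has_sum_infsum) (simp add: l2_def)
      then show ?case using Suc by (simp add: has_sum_add)
    qed simp
    from infsumI[OF this[of m]] show ?thesis by simp
  qed
  show ?thesis
    by (subst (1 2) swap) (simp_all add: b eigencombination_l2 pointwise)
qed

section \<open>Choosing the largest members of a finite family\<close>

lemma top_subset_exists:
  fixes lam :: "'i \<Rightarrow> real"
  assumes "finite I" "k \<le> card I"
  shows "\<exists>T\<subseteq>I. card T = k \<and> (\<forall>p\<in>T. \<forall>p'\<in>I - T. lam p' \<le> lam p)"
  using assms(2)
proof (induction k)
  case 0
  show ?case by (rule exI[of _ "{}"]) simp
next
  case (Suc k)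
  then obtain T where T: "T \<subseteq> I" "card T = k" "\<forall>p\<in>T. \<forall>p'\<in>I - T. lam p' \<le> lam p"
    by auto
  have fin: "finite (I - T)" "finite T"
    using assms(1) T(1) finite_subset by auto
  have "I - T \<noteq> {}"
    using Suc.prems T(1,2) by auto
  then obtain q where q: "q \<in> I - T" "\<forall>p'\<in>I - T. lam p' \<le> lam q"
    using Max_in[of "lam ` (I - T)"] Max_ge[of "lam ` (I - T)"] fin by fastforce
  show ?case
    by (rule exI[of _ "insert q T"]) (use T q fin in auto)
qed

lemma top_selection_exists:
  assumes "finite I"
  shows "\<exists>sel. top_selection I lam l sel"
proof -
  obtain T where T: "T \<subseteq> I" "card T = min l (card I)" "\<forall>p\<in>T. \<forall>p'\<in>I - T. lam p' \<le> lam p"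
    using top_subset_exists[OF assms, of "min l (card I)" lam] by auto
  obtain sel where "bij_betw sel {0..<card T} T"
    using ex_bij_betw_nat_finite[of T] T(1) assms finite_subset by blast
  then have "inj_on sel {..<min l (card I)}" "sel ` {..<min l (card I)} = T"
    by (auto simp: bij_betw_def T(2) lessThan_atLeast0)
  then show ?thesis
    using T unfolding top_selection_def by (intro exI[of _ sel]) simp
qed

text \<open>
  A linear program: to maximise \<open>\<Sum>p. lam p * w p\<close> with weights in \<open>[0, 1]\<close> of total at most \<open>l\<close>, put
  weight one on the \<open>l\<close> largest values. The largest value \<open>c\<close> outside \<open>T\<close> separates the two groups and serves
  as the dual variable: moving weight from outside \<open>T\<close> into \<open>T\<close> gains at least \<open>c\<close> and loses at most \<open>c\<close> per unit.
\<close>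

lemma weighted_sum_le_top_sum:
  fixes lam w :: "'i \<Rightarrow> real"
  assumes I: "finite I" and T: "T \<subseteq> I" "card T = min l (card I)"
    and top: "\<And>p p'. p \<in> T \<Longrightarrow> p' \<in> I - T \<Longrightarrow> lam p' \<le> lam p"
    and lam: "\<And>p. p \<in> I \<Longrightarrow> 0 \<le> lam p"
    and w: "\<And>p. p \<in> I \<Longrightarrow> 0 \<le> w p" "\<And>p. p \<in> I \<Longrightarrow> w p \<le> 1"
    and total: "(\<Sum>p\<in>I. w p) \<le> real l"
  shows "(\<Sum>p\<in>I. lam p * w p) \<le> (\<Sum>p\<in>T. lam p)"
proof (cases "T = I")
  case True
  show ?thesis
    unfolding True by (rule sum_mono) (use lam w mult_left_le in blast)
next
  case False
  then have ne: "I - T \<noteq> {}" using T(1) by blast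
  have fin: "finite T" "finite (I - T)" using I T(1) finite_subset by auto
  have cardT: "card T = l"
    using T False I card_subset_eq by (metis min_def)
  define c where "c = Max (lam ` (I - T))"
  have c_in: "c \<in> lam ` (I - T)"
    unfolding c_def using fin ne by (intro Max_in) auto
  have c_ge: "lam p \<le> c" if "p \<in> I - T" for p
    unfolding c_def using fin that by (intro Max_ge) auto
  have c0: "0 \<le> c" using c_in lam by auto
  have c_le: "c \<le> lam p" if "p \<in> T" for p using c_in top that by auto
  \<comment> \<open>Both sides are compared after splitting at \<open>T\<close>: on \<open>T\<close> the missing weight \<open>1 - w p\<close> costs at least \<open>c\<close> per unit.\<close>
  have split: "(\<Sum>p\<in>I. h p) = (\<Sum>p\<in>T. h p) + (\<Sum>p\<in>I - T. h p)" for h :: "'i \<Rightarrow> real"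
    using sum.subset_diff[OF T(1) I, of h] by simp
  have "(\<Sum>p\<in>I. lam p * w p) \<le> (\<Sum>p\<in>T. lam p - c * (1 - w p)) + (\<Sum>p\<in>I - T. c * w p)"
    unfolding split[of "\<lambda>p. lam p * w p"]
  proof (intro add_mono sum_mono)
    fix p assume p: "p \<in> T"
    then have "c * (1 - w p) \<le> lam p * (1 - w p)"
      using c_le w(2)[of p] T(1) by (intro mult_right_mono) auto
    then show "lam p * w p \<le> lam p - c * (1 - w p)"
      by (simp add: algebra_simps)
  next
    fix p assume "p \<in> I - T"
    then show "lam p * w p \<le> c * w p" using c_ge w(1) by (intro mult_right_mono) auto
  qed
  also have "\<dots> = (\<Sum>p\<in>T. lam p) + c * ((\<Sum>p\<in>I. w p) - real l)"
    unfolding split[of w]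
    by (simp add: sum_subtractf right_diff_distrib distrib_left cardT flip: sum_distrib_left)
  also have "\<dots> \<le> (\<Sum>p\<in>T. lam p)"
    using mult_nonneg_nonpos[OF c0, of "(\<Sum>p\<in>I. w p) - real l"] total by simp
  finally show ?thesis .
qed

section \<open>The optimal invariant subspace\<close>

text \<open>
  The data of the construction: a partition into blocks, and for each block an eigensystem of the Gramian of the
  truncated data.
\<close>

locale block_eigensystems =
  fixes N :: "'n set" and D :: "'n \<Rightarrow> 'a set" and m :: nat and a :: "nat \<Rightarrow> 'a \<Rightarrow> complex"
    and lam :: "'n \<Rightarrow> nat \<Rightarrow> real" and y :: "'n \<Rightarrow> nat \<Rightarrow> complex vec"
  assumes fin: "finite N" and disj: "disjoint_family_on D N" and cover: "(\<Union>\<sigma>\<in>N. D \<sigma>) = UNIV"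
    and a_l2: "\<And>k. k < m \<Longrightarrow> a k \<in> l2"
    and eig: "\<And>\<sigma>. \<sigma> \<in> N \<Longrightarrow>
      left_eigensystem m (gramian m (\<lambda>k. trunc (D \<sigma>) (a k))) (lam \<sigma>) (y \<sigma>)"
begin

definition idx :: "('n \<times> nat) set" where
  "idx = N \<times> {..<m}"

definition ev :: "'n \<times> nat \<Rightarrow> real" where
  "ev = (\<lambda>(\<sigma>, j). lam \<sigma> j)"

text \<open>
  The vectors \<open>v p\<close> are an orthogonal family carrying the same energy as the data; \<open>u p\<close> is \<open>v p\<close> normalised,
  with value zero where \<open>v p\<close> vanishes.
\<close>

definition v :: "'n \<times> nat \<Rightarrow> 'a \<Rightarrow> complex" where
  "v = (\<lambda>(\<sigma>, j). eigencombination m (\<lambda>k. trunc (D \<sigma>) (a k)) (y \<sigma> j))"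

definition u :: "'n \<times> nat \<Rightarrow> 'a \<Rightarrow> complex" where
  "u p = (if ev p = 0 then 0 else cscale (complex_of_real (ev p powr (- 1 / 2))) (v p))"

lemma finite_idx: "finite idx"
  by (simp add: idx_def fin)

lemma v_l2: "p \<in> idx \<Longrightarrow> v p \<in> l2"
  by (auto simp: v_def idx_def intro!: eigencombination_l2 l2_trunc a_l2)

lemma trunc_v:
  assumes "\<sigma> \<in> N" "p \<in> idx"
  shows "trunc (D \<sigma>) (v p) = (if fst p = \<sigma> then v p else 0)"
proof -
  obtain \<tau> j where p: "p = (\<tau>, j)" "\<tau> \<in> N" using assms(2) by (auto simp: idx_def)
  have v: "v p = trunc (D \<tau>) (eigencombination m a (y \<tau> j))"
    by (simp add: v_def p eigencombination_def trunc_sum trunc_scale)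
  have "trunc (D \<sigma>) (v p) = (if \<sigma> = \<tau> then v p else 0)"
    unfolding v by (rule trunc_blocks[OF disj assms(1) p(2)])
  then show ?thesis by (auto simp: p(1))
qed

lemma v_orthogonal:
  assumes "p \<in> idx" "p' \<in> idx"
  shows "l2_inner (v p) (v p') = (if p = p' then complex_of_real (ev p) else 0)"
proof -
  obtain \<sigma> i \<tau> j where p: "p = (\<sigma>, i)" "\<sigma> \<in> N" "i < m" "p' = (\<tau>, j)" "\<tau> \<in> N" "j < m"
    using assms by (auto simp: idx_def)
  show ?thesis
  proof (cases "\<sigma> = \<tau>")
    case True
    then show ?thesis
      using eigencombinations_orthogonal[OF l2_trunc[OF a_l2] eig[OF p(2)] p(3,6)]
      by (simp add: p v_def ev_def)
  next
    case False
    then show ?thesis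
      using l2_inner_blocks[OF disj p(2,5) False, of "v p" "v p'"]
        trunc_v[OF p(2) assms(1)] trunc_v[OF p(5) assms(2)] p by simp
  qed
qed

lemma ev_eq_norm:
  assumes "p \<in> idx"
  shows "ev p = (l2_norm (v p))\<^sup>2"
proof -
  have "complex_of_real (ev p) = complex_of_real ((l2_norm (v p))\<^sup>2)"
    using v_orthogonal[OF assms assms] l2_inner_self[OF v_l2[OF assms]] by simp
  then show ?thesis by (simp only: of_real_eq_iff)
qed

lemma ev_nonneg: "p \<in> idx \<Longrightarrow> 0 \<le> ev p"
  by (simp add: ev_eq_norm)

lemma v_eq_0: "p \<in> idx \<Longrightarrow> ev p = 0 \<Longrightarrow> v p = 0"
  using v_orthogonal[of p p] l2_inner_self_eq_0[OF v_l2, of p] by simp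

lemma sum_idx: "(\<Sum>p\<in>idx. f p) = (\<Sum>\<sigma>\<in>N. \<Sum>j<m. f (\<sigma>, j))"
  by (simp add: idx_def sum.cartesian_product)

text \<open>
  On the block that supports \<open>h\<close> this is unitarity of the coefficient matrix; the terms of all other blocks vanish.
\<close>

lemma captured_energy:
  assumes h: "h \<in> l2" and hom: "homogeneous N D h"
  shows "(\<Sum>k<m. (cmod (l2_inner (a k) h))\<^sup>2) = (\<Sum>p\<in>idx. (cmod (l2_inner (v p) h))\<^sup>2)"
proof -
  obtain \<tau> where \<tau>: "\<tau> \<in> N" "trunc (D \<tau>) h = h" using hom by (auto simp: homogeneous_def)
  have "(\<Sum>j<m. (cmod (l2_inner (v (\<sigma>, j)) h))\<^sup>2)
      = (if \<sigma> = \<tau> then \<Sum>k<m. (cmod (l2_inner (a k) h))\<^sup>2 else 0)" if \<sigma>: "\<sigma> \<in> N" for \<sigma>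
  proof -
    have "(\<Sum>j<m. (cmod (l2_inner (v (\<sigma>, j)) h))\<^sup>2)
        = (\<Sum>k<m. (cmod (l2_inner (trunc (D \<sigma>) (a k)) h))\<^sup>2)"
      using eigencombinations_capture[OF l2_trunc[OF a_l2] eig[OF \<sigma>] h] by (simp add: v_def)
    also have "\<dots> = (\<Sum>k<m. (cmod (l2_inner (a k) (trunc (D \<sigma>) (trunc (D \<tau>) h))))\<^sup>2)"
      by (simp only: l2_inner_trunc \<tau>(2))
    also have "\<dots> = (if \<sigma> = \<tau> then \<Sum>k<m. (cmod (l2_inner (a k) h))\<^sup>2 else 0)"
      unfolding trunc_blocks[OF disj \<sigma> \<tau>(1)] using \<tau>(2) by simp
    finally show ?thesis .
  qed
  then show ?thesis
    unfolding sum_idx using fin \<tau>(1) by simp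
qed

text \<open>
  Truncations to different blocks are orthogonal, so the norms of the data split over the blocks; in each block
  the unitary change of family preserves their sum.
\<close>

lemma total_energy: "(\<Sum>k<m. (l2_norm (a k))\<^sup>2) = (\<Sum>p\<in>idx. ev p)"
proof -
  have split: "(l2_norm (a k))\<^sup>2 = (\<Sum>\<sigma>\<in>N. (l2_norm (trunc (D \<sigma>) (a k)))\<^sup>2)" if k: "k < m" for k
  proof -
    have "complex_of_real ((l2_norm (a k))\<^sup>2) = l2_inner (\<Sum>\<sigma>\<in>N. trunc (D \<sigma>) (a k)) (a k)"
      by (simp only: sum_trunc_partition[OF fin disj cover] l2_inner_self[OF a_l2[OF k]])
    also have "\<dots> = (\<Sum>\<sigma>\<in>N. l2_inner (trunc (D \<sigma>) (a k)) (a k))"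
      by (rule l2_inner_sum_left) (use k a_l2 l2_trunc in auto)
    also have "\<dots> = (\<Sum>\<sigma>\<in>N. complex_of_real ((l2_norm (trunc (D \<sigma>) (a k)))\<^sup>2))"
    proof (rule sum.cong[OF refl])
      fix \<sigma>
      have "l2_inner (trunc (D \<sigma>) (a k)) (a k) = l2_inner (trunc (D \<sigma>) (a k)) (trunc (D \<sigma>) (a k))"
        by (simp only: l2_inner_trunc trunc_trunc Int_absorb)
      then show "l2_inner (trunc (D \<sigma>) (a k)) (a k)
          = complex_of_real ((l2_norm (trunc (D \<sigma>) (a k)))\<^sup>2)"
        by (simp only: l2_inner_self[OF l2_trunc[OF a_l2[OF k]]])
    qed
    finally show ?thesis by (simp only: of_real_eq_iff flip: of_real_sum)
  qed
  have "(\<Sum>p\<in>idx. ev p) = (\<Sum>p\<in>idx. (l2_norm (v p))\<^sup>2)"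
    by (rule sum.cong) (simp_all add: ev_eq_norm)
  also have "\<dots> = (\<Sum>\<sigma>\<in>N. \<Sum>j<m. (l2_norm (v (\<sigma>, j)))\<^sup>2)" by (rule sum_idx)
  also have "\<dots> = (\<Sum>\<sigma>\<in>N. \<Sum>k<m. (l2_norm (trunc (D \<sigma>) (a k)))\<^sup>2)"
  proof (rule sum.cong[OF refl])
    fix \<sigma> assume "\<sigma> \<in> N"
    then show "(\<Sum>j<m. (l2_norm (v (\<sigma>, j)))\<^sup>2) = (\<Sum>k<m. (l2_norm (trunc (D \<sigma>) (a k)))\<^sup>2)"
      using eigencombinations_total_norm[OF l2_trunc[OF a_l2] eig] by (simp add: v_def)
  qed
  also have "\<dots> = (\<Sum>k<m. \<Sum>\<sigma>\<in>N. (l2_norm (trunc (D \<sigma>) (a k)))\<^sup>2)" by (rule sum.swap)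
  also have "\<dots> = (\<Sum>k<m. (l2_norm (a k))\<^sup>2)" by (simp add: split)
  finally show ?thesis by simp
qed

lemma u_l2: "p \<in> idx \<Longrightarrow> u p \<in> l2"
  by (simp add: u_def l2_scale v_l2 l2_zero del: zero_fun_apply)

lemma trunc_u:
  assumes "\<sigma> \<in> N" "p \<in> idx"
  shows "trunc (D \<sigma>) (u p) = (if fst p = \<sigma> then u p else 0)"
  by (simp add: u_def trunc_scale trunc_v[OF assms] del: zero_fun_apply)

lemma ev_powr: "p \<in> idx \<Longrightarrow> ev p \<noteq> 0 \<Longrightarrow> ev p powr (- 1 / 2) * ev p powr (- 1 / 2) * ev p = 1"
  using ev_nonneg[of p] by (simp add: powr_minus_divide flip: powr_add)

lemma u_orthonormal:
  assumes "p \<in> idx" "p' \<in> idx" "ev p \<noteq> 0" "ev p' \<noteq> 0"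
  shows "l2_inner (u p) (u p') = (if p = p' then 1 else 0)"
proof -
  have "l2_inner (u p) (u p') = complex_of_real (ev p powr (- 1 / 2) * ev p' powr (- 1 / 2))
      * l2_inner (v p) (v p')"
    using assms by (simp add: u_def l2_inner_scale_left l2_inner_scale_right v_l2 l2_scale)
  also have "\<dots> = (if p = p' then complex_of_real (ev p powr (- 1 / 2) * ev p powr (- 1 / 2) * ev p) else 0)"
    using v_orthogonal[OF assms(1,2)] by simp
  finally show ?thesis by (simp only: ev_powr[OF assms(1,3)] of_real_1)
qed

text \<open>
  The passage to \<open>u\<close> splits the energy of \<open>v p\<close> seen by \<open>h\<close> into the eigenvalue and a weight between 0 and
  \<open>\<parallel>h\<parallel>\<^sup>2\<close>. If the eigenvalue is zero, both sides are zero.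
\<close>

lemma v_coefficient:
  assumes p: "p \<in> idx" and h: "h \<in> l2"
  shows "(cmod (l2_inner (v p) h))\<^sup>2 = ev p * (cmod (l2_inner (u p) h))\<^sup>2"
proof (cases "ev p = 0")
  case True
  then show ?thesis using v_eq_0[OF p True] by (simp del: zero_fun_apply)
next
  case False
  have "(cmod (l2_inner (u p) h))\<^sup>2 = (ev p powr (- 1 / 2) * ev p powr (- 1 / 2)) * (cmod (l2_inner (v p) h))\<^sup>2"
    using False by (simp add: u_def l2_inner_scale_left[OF v_l2[OF p] h] norm_mult power2_eq_square)
  then have "ev p * (cmod (l2_inner (u p) h))\<^sup>2
      = (ev p powr (- 1 / 2) * ev p powr (- 1 / 2) * ev p) * (cmod (l2_inner (v p) h))\<^sup>2"
    by (simp only: mult_ac)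
  then show ?thesis by (simp only: ev_powr[OF p False] mult_1)
qed

lemma orthonormal_u_image:
  assumes "T \<subseteq> {p \<in> idx. ev p \<noteq> 0}"
  shows "orthonormal (u ` T)" "inj_on u T"
proof -
  have "finite T" by (rule finite_subset[OF _ finite_idx]) (use assms in auto)
  moreover have "u p \<in> l2" if "p \<in> T" for p
    by (rule u_l2) (use assms that in auto)
  moreover have "l2_inner (u p) (u p') = (if p = p' then 1 else 0)" if "p \<in> T" "p' \<in> T" for p p'
    by (rule u_orthonormal) (use assms that in auto)
  ultimately have "orthonormal (u ` T) \<and> inj_on u T"
    using orthonormal_family[of T u] by blast
  then show "orthonormal (u ` T)" "inj_on u T" by simp_all
qed

lemma sum_u_image:
  assumes "T \<subseteq> idx"
  shows "(\<Sum>p\<in>T. (cmod (l2_inner h (u p)))\<^sup>2) = (\<Sum>e\<in>u ` {p \<in> T. ev p \<noteq> 0}. (cmod (l2_inner h e))\<^sup>2)"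
proof -
  have "(\<Sum>p\<in>T. (cmod (l2_inner h (u p)))\<^sup>2) = (\<Sum>p\<in>{p \<in> T. ev p \<noteq> 0}. (cmod (l2_inner h (u p)))\<^sup>2)"
    using finite_subset[OF assms finite_idx]
    by (intro sum.mono_neutral_right) (auto simp: u_def simp del: zero_fun_apply)
  also have "\<dots> = (\<Sum>e\<in>u ` {p \<in> T. ev p \<noteq> 0}. (cmod (l2_inner h e))\<^sup>2)"
    by (rule sum.reindex[unfolded comp_def, symmetric], rule orthonormal_u_image(2)) (use assms in auto)
  finally show ?thesis .
qed

lemma approx_error_eq:
  assumes E: "orthonormal E" "\<And>e. e \<in> E \<Longrightarrow> homogeneous N D e"
  shows "approx_error m a (cfun.span E)
    = (\<Sum>p\<in>idx. ev p) - (\<Sum>p\<in>idx. ev p * (\<Sum>e\<in>E. (cmod (l2_inner (u p) e))\<^sup>2))"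
proof -
  have El2: "e \<in> l2" if "e \<in> E" for e using E(1) that by (auto simp: orthonormal_def)
  have "(\<Sum>e\<in>E. \<Sum>k<m. (cmod (l2_inner (a k) e))\<^sup>2) = (\<Sum>e\<in>E. \<Sum>p\<in>idx. ev p * (cmod (l2_inner (u p) e))\<^sup>2)"
    by (rule sum.cong) (simp_all add: captured_energy El2 E(2) v_coefficient)
  also have "\<dots> = (\<Sum>p\<in>idx. \<Sum>e\<in>E. ev p * (cmod (l2_inner (u p) e))\<^sup>2)" by (rule sum.swap)
  finally show ?thesis
    by (simp add: approx_error_span[OF E(1) a_l2] total_energy sum_distrib_left)
qed

lemma cmod_l2_inner_commute: "cmod (l2_inner f g) = cmod (l2_inner g f)"
  by (subst l2_inner_commute) simp

text \<open>
  With \<open>w p = \<Sum>e\<in>E. \<bar>\<langle>u p, e\<rangle>\<bar>\<^sup>2\<close> for an adapted basis \<open>E\<close>, the captured energy is \<open>\<Sum>p. ev p * w p\<close>.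
  Bessel for \<open>E\<close> bounds each weight by \<open>\<parallel>u p\<parallel>\<^sup>2 \<le> 1\<close>, and Bessel for the \<open>u p\<close> bounds the total weight by
  \<open>\<Sum>e\<in>E. \<parallel>e\<parallel>\<^sup>2 = card E\<close>.
\<close>

lemma approx_error_lower_bound:
  assumes S: "S \<in> subspace_class N D l"
    and T: "T \<subseteq> idx" "card T = min l (card idx)"
    and top: "\<And>p p'. p \<in> T \<Longrightarrow> p' \<in> idx - T \<Longrightarrow> ev p' \<le> ev p"
  shows "(\<Sum>p\<in>idx - T. ev p) \<le> approx_error m a S"
proof -
  obtain E where E: "orthonormal E" "cfun.span E = S" "card E \<le> l" "\<And>e. e \<in> E \<Longrightarrow> homogeneous N D e"
    using adapted_orthonormal_basis[OF fin disj cover S] by blast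
  define w where "w p = (\<Sum>e\<in>E. (cmod (l2_inner (u p) e))\<^sup>2)" for p
  have w1: "w p \<le> 1" if p: "p \<in> idx" for p
  proof (cases "ev p = 0")
    case True
    then show ?thesis by (simp add: w_def u_def del: zero_fun_apply)
  next
    case False
    have "complex_of_real ((l2_norm (u p))\<^sup>2) = 1"
      using u_orthonormal[OF p p False False] l2_inner_self[OF u_l2[OF p]] by simp
    then have "(l2_norm (u p))\<^sup>2 = 1" by (simp only: of_real_eq_1_iff)
    then show ?thesis using bessel_inequality[OF E(1) u_l2[OF p]] by (simp add: w_def)
  qed
  have "(\<Sum>p\<in>idx. w p) = (\<Sum>e\<in>E. \<Sum>p\<in>idx. (cmod (l2_inner e (u p)))\<^sup>2)"
    unfolding w_def by (subst sum.swap) (simp only: cmod_l2_inner_commute[of "u _"])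
  also have "\<dots> \<le> (\<Sum>e\<in>E. 1)"
  proof (rule sum_mono)
    fix e assume e: "e \<in> E"
    have e_l2: "e \<in> l2" and "l2_inner e e = 1" using E(1) e by (auto simp: orthonormal_def)
    then have "(l2_norm e)\<^sup>2 = 1"
      using l2_inner_self[OF e_l2] by (metis of_real_eq_1_iff)
    then show "(\<Sum>p\<in>idx. (cmod (l2_inner e (u p)))\<^sup>2) \<le> 1"
      unfolding sum_u_image[OF subset_refl]
      using bessel_inequality[OF orthonormal_u_image(1)[OF subset_refl] e_l2] by simp
  qed
  also have "\<dots> \<le> real l" using E(3) by simp
  finally have "(\<Sum>p\<in>idx. w p) \<le> real l" .
  then have "(\<Sum>p\<in>idx. ev p * w p) \<le> (\<Sum>p\<in>T. ev p)"
    by (intro weighted_sum_le_top_sum[OF finite_idx T top ev_nonneg] w1)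
      (auto simp: w_def intro: sum_nonneg)
  then show ?thesis
    using approx_error_eq[OF E(1,4)] sum.subset_diff[OF T(1) finite_idx, of ev]
    unfolding E(2) w_def by simp
qed

lemma homogeneous_u:
  assumes "p \<in> idx"
  shows "homogeneous N D (u p)"
proof -
  have "fst p \<in> N" using assms by (auto simp: idx_def)
  moreover have "trunc (D (fst p)) (u p) = u p"
    using trunc_u[OF \<open>fst p \<in> N\<close> assms] by simp
  ultimately show ?thesis by (auto simp: homogeneous_def)
qed

text \<open>
  For this basis the weights are 1 on the selected indices with nonzero eigenvalue and 0 on the others, so the
  lower bound is attained. Indices with eigenvalue zero are left out because their \<open>u p\<close> is zero and not a unit vector.
\<close>

lemma approx_error_u_span:
  assumes "T \<subseteq> idx"
  shows "approx_error m a (cfun.span (u ` {p \<in> T. ev p \<noteq> 0})) = (\<Sum>p\<in>idx - T. ev p)"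
proof -
  let ?T = "{p \<in> T. ev p \<noteq> 0}"
  have E: "orthonormal (u ` ?T)" by (rule orthonormal_u_image) (use assms in auto)
  have "ev p * (\<Sum>e\<in>u ` ?T. (cmod (l2_inner (u p) e))\<^sup>2) = (if p \<in> T then ev p else 0)"
    if p: "p \<in> idx" for p
  proof (cases "ev p = 0")
    case False
    have "(\<Sum>e\<in>u ` ?T. (cmod (l2_inner (u p) e))\<^sup>2) = (\<Sum>p'\<in>?T. (cmod (l2_inner (u p) (u p')))\<^sup>2)"
      by (rule sum.reindex[unfolded comp_def], rule orthonormal_u_image(2)) (use assms in auto)
    also have "\<dots> = (\<Sum>p'\<in>?T. if p' = p then 1 else 0)"
    proof (rule sum.cong[OF refl])
      fix p' assume "p' \<in> ?T"
      then have "l2_inner (u p) (u p') = (if p = p' then 1 else 0)"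
        by (intro u_orthonormal) (use assms p False in auto)
      then show "(cmod (l2_inner (u p) (u p')))\<^sup>2 = (if p' = p then 1 else 0)" by auto
    qed
    also have "\<dots> = (if p \<in> T then 1 else 0)"
      using finite_subset[OF assms finite_idx] False by simp
    finally show ?thesis by simp
  qed simp
  then have "(\<Sum>p\<in>idx. ev p * (\<Sum>e\<in>u ` ?T. (cmod (l2_inner (u p) e))\<^sup>2)) = (\<Sum>p\<in>T. ev p)"
    using assms finite_idx by (simp add: sum.If_cases Int_absorb1)
  moreover have "homogeneous N D e" if "e \<in> u ` ?T" for e
    using that homogeneous_u assms by blast
  ultimately show ?thesis
    using approx_error_eq[OF E] sum.subset_diff[OF assms finite_idx, of ev] by simp
qed

lemma u_span_in_class:
  assumes T: "T \<subseteq> idx" "card T \<le> l"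
  shows "cfun.span (u ` T) \<in> subspace_class N D l"
proof -
  have fT: "finite T" by (rule finite_subset[OF T(1) finite_idx])
  have "cfun.dim (cfun.span (u ` T)) \<le> card (u ` T)"
    by (rule cfun.dim_le_card) (use fT in auto)
  then have "cfun.dim (cfun.span (u ` T)) \<le> l"
    using card_image_le[OF fT, of u] T(2) by linarith
  moreover have "cfun.span (u ` T) \<subseteq> l2"
    by (rule l2_span) (use T(1) u_l2 in auto)
  moreover have "trunc (D \<sigma>) f \<in> cfun.span (u ` T)" if \<sigma>: "\<sigma> \<in> N" and "f \<in> cfun.span (u ` T)" for \<sigma> f
    using that(2)
  proof (induction rule: cfun.span_induct_alt)
    case base
    show ?case by (simp only: trunc_zero cfun.span_zero)
  next
    case (step c x z)
    then obtain p where p: "p \<in> T" "x = u p" by auto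
    have "u p \<in> cfun.span (u ` T)" using p(1) by (intro cfun.span_base) simp
    then have "trunc (D \<sigma>) (u p) \<in> cfun.span (u ` T)"
      using trunc_u[OF \<sigma> subsetD[OF T(1) p(1)]] cfun.span_zero by metis
    then show ?case
      unfolding trunc_add trunc_scale p(2) by (intro cfun.span_add cfun.span_scale step)
  qed
  moreover have "\<exists>B. finite B \<and> cfun.span B = cfun.span (u ` T)"
    using fT by (intro exI[of _ "u ` T"]) simp
  ultimately show ?thesis
    using cfun.subspace_span[of "u ` T"] by (simp add: subspace_class_def image_subset_iff)
qed

lemma span_u_nonzero:
  "cfun.span (u ` {p \<in> T. ev p \<noteq> 0}) = cfun.span (u ` T)"
proof -
  have "u ` T - {0} = u ` {p \<in> T. ev p \<noteq> 0} - {0}"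
    by (auto simp: u_def)
  then have "cfun.span (u ` T - {0}) = cfun.span (u ` {p \<in> T. ev p \<noteq> 0} - {0})" by simp
  then show ?thesis by (simp only: cfun.span_delete_0)
qed

end

text \<open>
  The vectors \<open>q s\<close> are the selected \<open>u p\<close>, padded with zeros. The zeros change neither the span nor the sum in
  Parseval's identity, and what remains is an orthonormal basis.
\<close>

lemma q_vec_span_optimal:
  fixes sel :: "nat \<Rightarrow> 'n \<times> nat"
  assumes blocks: "block_eigensystems N D m a lam y"
    and sel: "top_selection (N \<times> {..<m}) (\<lambda>(\<sigma>, j). lam \<sigma> j) l sel"
  defines "q \<equiv> q_vec N D m a lam y sel"
    and "S \<equiv> cfun.span (q_vec N D m a lam y sel ` {..<l})"
  shows "S \<in> subspace_class N D l"
    and "S' \<in> subspace_class N D l \<Longrightarrow> approx_error m a S \<le> approx_error m a S'"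
    and "parseval_frame {..<l} q S"
    and "approx_error m a S
      = (\<Sum>(\<sigma>, j) \<in> N \<times> {..<m} - sel ` {..<min l (card (N \<times> {..<m}))}. lam \<sigma> j)"
proof -
  interpret block_eigensystems N D m a lam y by (rule blocks)
  define n where "n = min l (card idx)"
  define T where "T = sel ` {..<n}"
  have inj: "inj_on sel {..<n}" and T: "T \<subseteq> idx"
    and top: "\<And>p p'. p \<in> T \<Longrightarrow> p' \<in> idx - T \<Longrightarrow> ev p' \<le> ev p"
    using sel unfolding top_selection_def n_def T_def idx_def ev_def by blast+
  have cardT: "card T = min l (card idx)"
    unfolding T_def card_image[OF inj] by (simp add: n_def)
  have q_eq: "q s = (if s < card idx then u (sel s) else 0)" for s
    by (cases "sel s") (simp add: q_def q_vec_def idx_def u_def ev_def v_def eigencombination_def)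
  have q_diff: "q ` {..<l} - {0} = u ` T - {0}"
    by (auto simp: q_eq T_def n_def)
  have S: "S = cfun.span (u ` T)"
  proof -
    have "cfun.span (q ` {..<l} - {0}) = cfun.span (u ` T - {0})" by (simp only: q_diff)
    then show ?thesis unfolding S_def q_def[symmetric] by (simp only: cfun.span_delete_0)
  qed
  show "S \<in> subspace_class N D l"
    unfolding S by (rule u_span_in_class[OF T]) (simp add: cardT)
  have err: "approx_error m a S = (\<Sum>p\<in>idx - T. ev p)"
    using approx_error_u_span[OF T] by (simp only: S span_u_nonzero)
  then show "approx_error m a S
      = (\<Sum>(\<sigma>, j) \<in> N \<times> {..<m} - sel ` {..<min l (card (N \<times> {..<m}))}. lam \<sigma> j)"
    by (simp add: T_def n_def idx_def ev_def)
  show "approx_error m a S \<le> approx_error m a S'" if "S' \<in> subspace_class N D l"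
    unfolding err using approx_error_lower_bound[OF that T cardT top] by simp
  show "parseval_frame {..<l} q S"
    unfolding parseval_frame_def
  proof (intro conjI ballI)
    fix s assume "s \<in> {..<l}"
    then show "q s \<in> S" unfolding S_def q_def by (intro cfun.span_base) auto
  next
    fix f assume f: "f \<in> S"
    have "(\<Sum>s<l. (cmod (l2_inner f (q s)))\<^sup>2) = (\<Sum>s<n. (cmod (l2_inner f (u (sel s))))\<^sup>2)"
      by (rule sum.mono_neutral_cong_right) (auto simp: q_eq n_def simp del: zero_fun_apply)
    also have "\<dots> = (\<Sum>p\<in>T. (cmod (l2_inner f (u p)))\<^sup>2)"
      unfolding T_def by (simp add: sum.reindex[OF inj])
    also have "\<dots> = (\<Sum>e\<in>u ` {p \<in> T. ev p \<noteq> 0}. (cmod (l2_inner f e))\<^sup>2)"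
      by (rule sum_u_image[OF T])
    also have "\<dots> = (l2_norm f)\<^sup>2"
    proof (rule parseval_identity)
      show "orthonormal (u ` {p \<in> T. ev p \<noteq> 0})"
        by (rule orthonormal_u_image) (use T in auto)
      show "f \<in> cfun.span (u ` {p \<in> T. ev p \<noteq> 0})"
        using f unfolding S span_u_nonzero .
    qed
    finally show "((\<lambda>i. (cmod (l2_inner f (q i)))\<^sup>2) has_sum (l2_norm f)\<^sup>2) {..<l}"
      by (intro has_sum_finiteI) simp_all
  qed
qed

lemma gramian_eigensystem_exists:
  assumes "\<And>k. k < m \<Longrightarrow> b k \<in> l2"
  shows "\<exists>lam y. left_eigensystem m (gramian m b) lam y"
proof (rule left_eigensystem_exists)
  show "gramian m b $$ (r, s) = cnj (gramian m b $$ (s, r))" if "r < m" "s < m" for r s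
    using that l2_inner_commute[of "b r" "b s"] by (simp add: gramian_def)
qed (simp add: gramian_def)

theorem theorem5p1:
  fixes m l :: nat
    and N :: "'n set"
    and D :: "'n \<Rightarrow> (int ^ 'd) set"
    and a :: "nat \<Rightarrow> int ^ 'd \<Rightarrow> complex"
  assumes "finite N"
    and "disjoint_family_on D N" and "(\<Union>\<sigma>\<in>N. D \<sigma>) = UNIV"
    and "\<And>k. k < m \<Longrightarrow> a k \<in> l2"
  shows "(\<exists>S\<in>subspace_class N D l. \<forall>S'\<in>subspace_class N D l.
            approx_error m a S \<le> approx_error m a S')
    \<and> (\<forall>lam y sel.
          (\<forall>\<sigma>\<in>N. left_eigensystem m (gramian m (\<lambda>k. trunc (D \<sigma>) (a k))) (lam \<sigma>) (y \<sigma>))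
          \<and> top_selection (N \<times> {..<m}) (\<lambda>(\<sigma>, j). lam \<sigma> j) l sel
        \<longrightarrow> (\<exists>S\<in>subspace_class N D l.
               (\<forall>S'\<in>subspace_class N D l. approx_error m a S \<le> approx_error m a S')
             \<and> S = cfun.span (q_vec N D m a lam y sel ` {..<l})
             \<and> parseval_frame {..<l} (q_vec N D m a lam y sel) S
             \<and> approx_error m a S =
                 (\<Sum>(\<sigma>, j) \<in> N \<times> {..<m} - sel ` {..<min l (card (N \<times> {..<m}))}. lam \<sigma> j)))"
    (is "?existence \<and> (\<forall>lam y sel. ?data lam y sel \<longrightarrow> ?solution lam y sel)")
proof -
  have optimal: "?solution lam y sel" if data: "?data lam y sel" for lam y sel
  proof -
    have blocks: "block_eigensystems N D m a lam y"
      using assms data by unfold_locales auto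
    note opt = q_vec_span_optimal[OF blocks conjunct2[OF data]]
    show ?thesis by (rule bexI[OF _ opt(1)], intro conjI ballI refl opt(2-4))
  qed
  have "\<forall>\<sigma>. \<exists>lam y. left_eigensystem m (gramian m (\<lambda>k. trunc (D \<sigma>) (a k))) lam y"
    by (intro allI gramian_eigensystem_exists l2_trunc assms(4))
  then obtain lam y where "\<And>\<sigma>. left_eigensystem m (gramian m (\<lambda>k. trunc (D \<sigma>) (a k))) (lam \<sigma>) (y \<sigma>)"
    by metis
  moreover obtain sel where "top_selection (N \<times> {..<m}) (\<lambda>(\<sigma>, j). lam \<sigma> j) l sel"
    using top_selection_exists[of "N \<times> {..<m}"] assms(1) by blast
  ultimately have "?existence" using optimal[of lam y sel] by blast
  then show ?thesis using optimal by blast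
qed

end
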